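(* Let $n$ be even and let $G=(V,E)\sim G(n,1/2)$ with $V=[n]$. Let $X$ be the $\pm1$ adjacency matrix of $G$, with spectral decomposition $X=\sum_{k=1}^n\lambda_k u_ku_k^T$, $\lambda_1\ge\dots\ge\lambda_n$, $u_1,\dots,u_n$ orthonormal. Let $X^+=\sum_{k=1}^{n/2}\lambda_ku_ku_k^T$, $X^-=\sum_{k=n/2+1}^{n}\lambda_ku_ku_k^T$, and $Z=X^--X^+$. Then for any $\varepsilon\in(0,1/4)$, with probability at least $1-O(n^{-1}\,\mathrm{polylog}\, n)$, $$\frac{1}{|E|}\sum_{(i,j)\in E}X^+_{ij}=\frac12\pm O(n^{2\varepsilon-1/2}),\qquad \frac{1}{|E|}\sum_{(i,j)\in E}X^-_{ij}=\frac12\pm O(n^{2\varepsilon-1/2}),$$ $$\frac{1}{|\overline{E}|}\sum_{(i,j)\notin E}X^+_{ij}=-\frac12\pm O(n^{2\varepsilon-1/2}),\qquad \frac{1}{|\overline{E}|}\sum_{(i,j)\notin E}X^-_{ij}=-\frac12\pm O(n^{2\varepsilon-1/2}).$$ Consequently, $\left|\frac{1}{|E|}\sum_{(i,j)\in E}Z_{ij}\right|\le O(n^{2\varepsilon-1/2})$ and $\left|\frac{1}{|\overline{E}|}\sum_{(i,j)\notin E}Z_{ij}\right|\le O(n^{2\varepsilon-1/2})$.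
   Context: $G(n,1/2)$ is the Erdős–Rényi random graph on $[n]$ where each pair is an edge independently with probability $1/2$. The $\pm1$ adjacency matrix $X$ of $G$ is the symmetric matrix with $X_{ii}=0$, $X_{ij}=1$ if $\{i,j\}$ is an edge and $X_{ij}=-1$ otherwise ($i\ne j$). Here $E$ is regarded as the set of ordered pairs $(i,j)$ with $\{i,j\}$ an edge, sums over $(i,j)\notin E$ range over ordered pairs in $[n]^2$ not in $E$, and $\overline{E}$ denotes that set of pairs. *)

theory Defs
  imports "HOL-Probability.Probability"
begin

text \<open>Vertices are 0..<n. A graph is a set of unordered pairs (2-element sets).\<close>

definition all_pairs :: "nat \<Rightarrow> nat set set" where
  "all_pairs n = {{i, j} | i j. i < j \<and> j < n}"

definition gnp_half :: "nat \<Rightarrow> nat set set pmf" where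
  "gnp_half n = pmf_of_set (Pow (all_pairs n))"

definition pm_adj :: "nat set set \<Rightarrow> nat \<Rightarrow> nat \<Rightarrow> real" where
  "pm_adj G i j = (if i = j then 0 else if {i, j} \<in> G then 1 else -1)"

definition edge_pairs :: "nat \<Rightarrow> nat set set \<Rightarrow> (nat \<times> nat) set" where
  "edge_pairs n G = {(i, j). i < n \<and> j < n \<and> i \<noteq> j \<and> {i, j} \<in> G}"

definition nonedge_pairs :: "nat \<Rightarrow> nat set set \<Rightarrow> (nat \<times> nat) set" where
  "nonedge_pairs n G = ({..<n} \<times> {..<n}) - edge_pairs n G"

definition is_spectral_decomp ::
  "nat \<Rightarrow> (nat \<Rightarrow> nat \<Rightarrow> real) \<Rightarrow> (nat \<Rightarrow> real) \<Rightarrow> (nat \<Rightarrow> nat \<Rightarrow> real) \<Rightarrow> bool" where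
  "is_spectral_decomp n X lam u \<longleftrightarrow>
     (\<forall>k l. k \<le> l \<and> l < n \<longrightarrow> lam l \<le> lam k) \<and>
     (\<forall>k<n. \<forall>l<n. (\<Sum>i<n. u k i * u l i) = (if k = l then 1 else 0)) \<and>
     (\<forall>i<n. \<forall>j<n. X i j = (\<Sum>k<n. lam k * u k i * u k j))"

definition part_plus :: "nat \<Rightarrow> (nat \<Rightarrow> real) \<Rightarrow> (nat \<Rightarrow> nat \<Rightarrow> real) \<Rightarrow> nat \<Rightarrow> nat \<Rightarrow> real" where
  "part_plus n lam u i j = (\<Sum>k<n div 2. lam k * u k i * u k j)"

definition part_minus :: "nat \<Rightarrow> (nat \<Rightarrow> real) \<Rightarrow> (nat \<Rightarrow> nat \<Rightarrow> real) \<Rightarrow> nat \<Rightarrow> nat \<Rightarrow> real" where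
  "part_minus n lam u i j = (\<Sum>k\<in>{n div 2..<n}. lam k * u k i * u k j)"

definition avg_over :: "(nat \<times> nat) set \<Rightarrow> (nat \<Rightarrow> nat \<Rightarrow> real) \<Rightarrow> real" where
  "avg_over S M = (\<Sum>(i, j)\<in>S. M i j) / real (card S)"

end

theory Submission
  imports Defs
begin

text \<open>
  Summing a matrix \<open>M\<close> over the edges gives \<open>(1\<^sup>T M 1 - tr M + \<langle>X, M\<rangle>) / 2\<close>. For \<open>M = X\<^sup>+\<close> the first term is at most
  \<open>|1| |X 1|\<close> and the second at most \<open>n\<^bsup>3/2\<^esup>\<close>, so everything reduces to showing that the energy
  \<open>\<langle>X, X\<^sup>+\<rangle>\<close>, the sum of \<open>\<lambda>\<^sub>k\<^sup>2\<close> over \<open>k \<le> n/2\<close>, is half of the total energy \<open>n (n - 1)\<close> up to \<open>O(n\<^bsup>3/2\<^esup>)\<close>.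

  The truncated energy \<open>P\<^sub>s = \<Sum> max 0 (\<lambda>\<^sub>k - s)\<^sup>2\<close> is a supremum of affine functions of \<open>X\<close>, namely of
  \<open>2 \<langle>X, S\<rangle> - 2 s tr S - |S|\<^sup>2\<close> over positive semidefinite \<open>S\<close>. By the Efron-Stein inequality its
  variance is \<open>O(n\<^sup>2)\<close>, so by Chebyshev it deviates from its mean by \<open>n\<^bsup>3/2\<^esup>\<close> with probability \<open>O(1/n)\<close>
  only. Complementing the graph negates \<open>X\<close>, hence the corresponding energy \<open>N\<^sub>s\<close> of \<open>- X\<close> has the
  same mean, and \<open>P\<^sub>s - N\<^sub>s = O(n\<^bsup>3/2\<^esup>)\<close>. For \<open>s = 0\<close> this balances the positive against the negative
  eigenvalues; the dyadic values of \<open>s\<close>, over which a union bound costs a factor \<open>log n\<close>, bound the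
  energy of the eigenvalues that lie between \<open>0\<close> and the median.
\<close>

section \<open>The Efron-Stein inequality on the subsets of a finite set\<close>

definition flip :: "'a \<Rightarrow> 'a set \<Rightarrow> 'a set" where
  "flip e G = (if e \<in> G then G - {e} else insert e G)"

lemma flip_flip [simp]: "flip e (flip e G) = G"
  by (auto simp: flip_def)

lemma flip_in_Pow: "e \<in> A \<Longrightarrow> G \<in> Pow A \<Longrightarrow> flip e G \<in> Pow A"
  by (auto simp: flip_def)

lemma sum_Pow_flip:
  assumes "e \<in> A"
  shows "(\<Sum>G\<in>Pow A. f (flip e G)) = (\<Sum>G\<in>Pow A. f G)"
  using assms
  by (intro sum.reindex_bij_witness[of _ "flip e" "flip e"]) (auto simp: flip_in_Pow[unfolded Pow_iff])

lemma sum_Pow_Diff: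
  "(\<Sum>G\<in>Pow A. f (A - G)) = (\<Sum>G\<in>Pow A. f G)"
  by (intro sum.reindex_bij_witness[of _ "\<lambda>G. A - G" "\<lambda>G. A - G"]) auto

lemma sum_Pow_insert:
  assumes "finite A" "a \<notin> A"
  shows "(\<Sum>G\<in>Pow (insert a A). f G) = (\<Sum>G\<in>Pow A. f G + f (insert a G))"
proof -
  have inj: "inj_on (insert a) (Pow A)"
    using assms(2) by (auto simp: inj_on_def)
  have "(\<Sum>G\<in>Pow (insert a A). f G) = (\<Sum>G\<in>Pow A. f G) + (\<Sum>G\<in>insert a ` Pow A. f G)"
    unfolding Pow_insert using assms by (intro sum.union_disjoint) auto
  also have "(\<Sum>G\<in>insert a ` Pow A. f G) = (\<Sum>G\<in>Pow A. f (insert a G))"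
    by (simp add: sum.reindex[OF inj])
  finally show ?thesis by (simp add: sum.distrib)
qed

text \<open>Induction on \<open>A\<close>: averaging \<open>f\<close> over the status of
  \<open>a\<close> gives \<open>g\<close>. The variance of \<open>f\<close> is that of
  \<open>g\<close> plus a part caused by \<open>a\<close>, which the flips of \<open>a\<close> match
  exactly; by convexity of the square, the squared flip differences of \<open>g\<close> are at most
  the average of those of \<open>f\<close>. The factor 1/4 is the usual 1/2 times the chance 1/2
  that a resampled bit changes.\<close>

lemma efron_stein_Pow:
  fixes f :: "'a set \<Rightarrow> real"
  assumes "finite A"
  shows "(\<Sum>G\<in>Pow A. (f G)\<^sup>2) - (\<Sum>G\<in>Pow A. f G)\<^sup>2 / 2 ^ card A
     \<le> (\<Sum>G\<in>Pow A. \<Sum>e\<in>A. (f G - f (flip e G))\<^sup>2) / 4"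
  using assms
proof (induction A arbitrary: f rule: finite_induct)
  case empty
  then show ?case by simp
next
  case (insert a A)
  define g where "g G = (f G + f (insert a G)) / 2" for G
  define d where "d G = (f G - f (insert a G))\<^sup>2" for G
  have fl: "flip e (insert a G) = insert a (flip e G)" if "e \<in> A" for e G
    using that insert.hyps by (auto simp: flip_def)
  have fa: "flip a G = insert a G" "flip a (insert a G) = G" if "G \<in> Pow A" for G
    using that insert.hyps by (auto simp: flip_def)
  have s1: "(\<Sum>G\<in>Pow (insert a A). f G) = 2 * (\<Sum>G\<in>Pow A. g G)"
    unfolding sum_Pow_insert[OF insert.hyps] g_def sum_distrib_left by (intro sum.cong refl) simp
  have s2: "(\<Sum>G\<in>Pow (insert a A). (f G)\<^sup>2) = 2 * (\<Sum>G\<in>Pow A. (g G)\<^sup>2) + (\<Sum>G\<in>Pow A. d G) / 2"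
    unfolding sum_Pow_insert[OF insert.hyps] g_def d_def sum_distrib_left sum_divide_distrib
      sum.distrib[symmetric]
    by (intro sum.cong refl) (simp add: power2_eq_square field_simps)
  have s3: "(\<Sum>G\<in>Pow (insert a A). \<Sum>e\<in>insert a A. (f G - f (flip e G))\<^sup>2)
      = (\<Sum>G\<in>Pow A. 2 * d G + (\<Sum>e\<in>A. (f G - f (flip e G))\<^sup>2
           + (f (insert a G) - f (insert a (flip e G)))\<^sup>2))"
    unfolding sum_Pow_insert[OF insert.hyps]
    by (intro sum.cong refl)
      (simp add: insert.hyps fa fl d_def sum.distrib power2_commute)
  have s4: "2 * (g G - g (flip e G))\<^sup>2 \<le> (f G - f (flip e G))\<^sup>2
           + (f (insert a G) - f (insert a (flip e G)))\<^sup>2" for G e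
  proof -
    have "0 \<le> ((f G - f (flip e G)) - (f (insert a G) - f (insert a (flip e G))))\<^sup>2" by simp
    then show ?thesis unfolding g_def by (simp add: power2_eq_square field_simps)
  qed
  have "(\<Sum>G\<in>Pow A. (g G)\<^sup>2) - (\<Sum>G\<in>Pow A. g G)\<^sup>2 / 2 ^ card A
     \<le> (\<Sum>G\<in>Pow A. \<Sum>e\<in>A. (g G - g (flip e G))\<^sup>2) / 4"
    by (rule insert.IH)
  moreover have "2 * (\<Sum>G\<in>Pow A. \<Sum>e\<in>A. (g G - g (flip e G))\<^sup>2)
      \<le> (\<Sum>G\<in>Pow A. \<Sum>e\<in>A. (f G - f (flip e G))\<^sup>2
           + (f (insert a G) - f (insert a (flip e G)))\<^sup>2)"
    unfolding sum_distrib_left by (intro sum_mono s4)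
  moreover have "(2 * (\<Sum>G\<in>Pow A. g G))\<^sup>2 / 2 ^ card (insert a A)
     = 2 * ((\<Sum>G\<in>Pow A. g G)\<^sup>2 / 2 ^ card A)"
    using insert.hyps by (simp add: power_mult_distrib)
  ultimately show ?case
    unfolding s1 s2 s3 sum.distrib sum_distrib_left[symmetric] by simp
qed

definition Pow_mean :: "'a set \<Rightarrow> ('a set \<Rightarrow> real) \<Rightarrow> real" where
  "Pow_mean A f = (\<Sum>G\<in>Pow A. f G) / 2 ^ card A"

text \<open>Since \<open>flip e\<close> is an involution, only decreases of \<open>f\<close> have to be controlled.\<close>

lemma variance_Pow_le:
  fixes f :: "'a set \<Rightarrow> real"
  assumes A: "finite A"
  shows "(\<Sum>G\<in>Pow A. (f G - Pow_mean A f)\<^sup>2)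
     \<le> (\<Sum>G\<in>Pow A. \<Sum>e\<in>A. (max 0 (f G - f (flip e G)))\<^sup>2) / 2"
proof -
  let ?\<mu> = "Pow_mean A f"
  have c: "real (card (Pow A)) = 2 ^ card A" using A by (simp add: card_Pow)
  have "(\<Sum>G\<in>Pow A. (f G - ?\<mu>)\<^sup>2)
      = (\<Sum>G\<in>Pow A. (f G)\<^sup>2) - 2 * ?\<mu> * (\<Sum>G\<in>Pow A. f G) + 2 ^ card A * ?\<mu>\<^sup>2"
    by (simp add: power2_diff sum.distrib sum_subtractf sum_distrib_left mult_ac c)
  also have "\<dots> = (\<Sum>G\<in>Pow A. (f G)\<^sup>2) - (\<Sum>G\<in>Pow A. f G)\<^sup>2 / 2 ^ card A"
    by (simp add: Pow_mean_def power2_eq_square field_simps)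
  also have "\<dots> \<le> (\<Sum>G\<in>Pow A. \<Sum>e\<in>A. (f G - f (flip e G))\<^sup>2) / 4"
    by (rule efron_stein_Pow[OF A])
  also have "(\<Sum>G\<in>Pow A. \<Sum>e\<in>A. (f G - f (flip e G))\<^sup>2)
     = (\<Sum>e\<in>A. \<Sum>G\<in>Pow A. (f G - f (flip e G))\<^sup>2)"
    by (rule sum.swap)
  also have "\<dots> = (\<Sum>e\<in>A. 2 * (\<Sum>G\<in>Pow A. (max 0 (f G - f (flip e G)))\<^sup>2))"
  proof (intro sum.cong refl)
    fix e assume e: "e \<in> A"
    \<comment> \<open>A square is the sum of the squares of the positive and the negative part, and
      the negative part at \<open>G\<close> is the positive part at \<open>flip e G\<close>.\<close>
    have "(\<Sum>G\<in>Pow A. (f G - f (flip e G))\<^sup>2)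
      = (\<Sum>G\<in>Pow A. (max 0 (f G - f (flip e G)))\<^sup>2)
        + (\<Sum>G\<in>Pow A. (max 0 (f (flip e G) - f (flip e (flip e G))))\<^sup>2)"
      unfolding sum.distrib[symmetric]
      by (intro sum.cong refl) (auto simp: max_def power2_commute)
    also have "(\<Sum>G\<in>Pow A. (max 0 (f (flip e G) - f (flip e (flip e G))))\<^sup>2)
      = (\<Sum>G\<in>Pow A. (max 0 (f G - f (flip e G)))\<^sup>2)"
      by (rule sum_Pow_flip[OF e])
    finally show "(\<Sum>G\<in>Pow A. (f G - f (flip e G))\<^sup>2)
      = 2 * (\<Sum>G\<in>Pow A. (max 0 (f G - f (flip e G)))\<^sup>2)" by simp
  qed
  also have "\<dots> = 2 * (\<Sum>G\<in>Pow A. \<Sum>e\<in>A. (max 0 (f G - f (flip e G)))\<^sup>2)"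
    unfolding sum_distrib_left[symmetric] by (subst sum.swap) (rule refl)
  finally show ?thesis by simp
qed

section \<open>Row sums of the adjacency matrix\<close>

lemma finite_all_pairs [simp]: "finite (all_pairs n)"
proof -
  have "all_pairs n \<subseteq> Pow {..<n}" by (auto simp: all_pairs_def)
  then show ?thesis by (rule finite_subset) simp
qed

lemma pair_in_all_pairs: "i < n \<Longrightarrow> j < n \<Longrightarrow> i \<noteq> j \<Longrightarrow> {i, j} \<in> all_pairs n"
  unfolding all_pairs_def by (cases "i < j") (fastforce simp: insert_commute)+

text \<open>Each edge is charged to its ordered pair with \<open>i < j\<close>. Since
  \<open>h\<close> is nonnegative, adding the reversed and the diagonal pairs only increases the
  sum, so bounds per edge may be summed over the whole square.\<close>

lemma sum_all_pairs_le:
  fixes g :: "nat set \<Rightarrow> real" and h :: "nat \<Rightarrow> nat \<Rightarrow> real"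
  assumes "\<And>i j. i < n \<Longrightarrow> j < n \<Longrightarrow> i \<noteq> j \<Longrightarrow> g {i, j} \<le> h i j" and "\<And>i j. 0 \<le> h i j"
  shows "(\<Sum>e\<in>all_pairs n. g e) \<le> (\<Sum>i<n. \<Sum>j<n. h i j)"
proof -
  let ?D = "{(i, j). i < j \<and> j < n}"
  have fin: "finite ?D" by (rule finite_subset[of _ "{..<n} \<times> {..<n}"]) auto
  have inj: "inj_on (\<lambda>(i, j). {i, j}) ?D"
    by (auto simp: inj_on_def doubleton_eq_iff)
  have "all_pairs n = (\<lambda>(i, j). {i, j}) ` ?D"
    by (auto simp: all_pairs_def)
  then have "(\<Sum>e\<in>all_pairs n. g e) = (\<Sum>(i, j)\<in>?D. g {i, j})"
    using inj by (simp add: sum.reindex case_prod_unfold comp_def)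
  also have "\<dots> \<le> (\<Sum>(i, j)\<in>?D. h i j)"
    using assms(1) by (intro sum_mono) auto
  also have "\<dots> \<le> (\<Sum>(i, j)\<in>{..<n} \<times> {..<n}. h i j)"
    using fin assms(2) by (intro sum_mono2) auto
  finally show ?thesis by (simp add: sum.cartesian_product)
qed

section \<open>Chebyshev's inequality for the uniform random graph\<close>

lemma prob_gnp_half:
  "measure_pmf.prob (gnp_half n) S = real (card (Pow (all_pairs n) \<inter> S)) / 2 ^ card (all_pairs n)"
  unfolding gnp_half_def by (subst measure_pmf_of_set) (auto simp: card_Pow)

lemma chebyshev_gnp_half:
  fixes f :: "nat set set \<Rightarrow> real"
  assumes V: "(\<Sum>G\<in>Pow (all_pairs n). (f G - \<mu>)\<^sup>2) \<le> 2 ^ card (all_pairs n) * V" and t: "t > 0"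
  shows "measure_pmf.prob (gnp_half n) {G. \<bar>f G - \<mu>\<bar> \<ge> t} \<le> V / t\<^sup>2"
proof -
  let ?A = "all_pairs n"
  let ?S = "Pow ?A \<inter> {G. \<bar>f G - \<mu>\<bar> \<ge> t}"
  have "real (card ?S) * t\<^sup>2 = (\<Sum>G\<in>?S. t\<^sup>2)" by simp
  also have "\<dots> \<le> (\<Sum>G\<in>?S. (f G - \<mu>)\<^sup>2)"
    using t by (intro sum_mono) (auto simp: abs_le_square_iff[symmetric])
  also have "\<dots> \<le> (\<Sum>G\<in>Pow ?A. (f G - \<mu>)\<^sup>2)"
    by (intro sum_mono2) auto
  finally have "real (card ?S) * t\<^sup>2 \<le> 2 ^ card ?A * V" using V by linarith
  then show ?thesis unfolding prob_gnp_half using t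
    by (simp add: field_simps)
qed

section \<open>The adjacency matrix under complements and flips\<close>

lemma pm_adj_complement:
  "i < n \<Longrightarrow> j < n \<Longrightarrow> pm_adj (all_pairs n - G) i j = - pm_adj G i j"
  by (auto simp: pm_adj_def pair_in_all_pairs)

text \<open>Nested conditionals on one index each let the double sums over \<open>a\<close> and
  \<open>b\<close> collapse by simplification.\<close>

lemma pm_adj_flip:
  assumes "i \<noteq> j"
  shows "pm_adj G a b - pm_adj (flip {i, j} G) a b =
    (if a = i then if b = j then 2 * pm_adj G i j else 0 else 0) +
    (if a = j then if b = i then 2 * pm_adj G i j else 0 else 0)"
  using assms by (auto simp: pm_adj_def flip_def doubleton_eq_iff insert_commute)

lemma pm_adj_sq: "(pm_adj G i j)\<^sup>2 = (if i = j then 0 else 1)"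
  by (simp add: pm_adj_def)

lemma abs_pm_adj_le: "\<bar>pm_adj G i j\<bar> \<le> 1"
  by (simp add: pm_adj_def)

definition row_sum :: "nat \<Rightarrow> nat set set \<Rightarrow> nat \<Rightarrow> real" where
  "row_sum n G i = (\<Sum>j<n. pm_adj G i j)"

lemma row_sum_flip:
  assumes "i \<noteq> j" "i < n" "j < n"
  shows "row_sum n (flip {i, j} G) a = row_sum n G a -
    (if a = i \<or> a = j then 2 * pm_adj G i j else 0)"
proof -
  have "row_sum n G a - row_sum n (flip {i, j} G) a =
    (\<Sum>b<n. (if a = i then if b = j then 2 * pm_adj G i j else 0 else 0) +
    (if a = j then if b = i then 2 * pm_adj G i j else 0 else 0))"
    unfolding row_sum_def sum_subtractf[symmetric] pm_adj_flip[OF assms(1)] ..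
  also have "\<dots> = (if a = i \<or> a = j then 2 * pm_adj G i j else 0)"
    using assms by (auto simp: sum.distrib)
  finally show ?thesis by simp
qed

text \<open>Complementing the graph negates the row sum, so the mean is zero and the second moment
  is the variance. A flip changes this row sum by 2 if the pair contains \<open>i\<close>, and not
  at all otherwise.\<close>

lemma row_sum_second_moment:
  assumes "i < n"
  shows "(\<Sum>G\<in>Pow (all_pairs n). (row_sum n G i)\<^sup>2) \<le> 2 ^ card (all_pairs n) * (4 * real n)"
proof -
  let ?A = "all_pairs n"
  let ?f = "\<lambda>G. row_sum n G i"
  have "(\<Sum>G\<in>Pow ?A. ?f G) = (\<Sum>G\<in>Pow ?A. - ?f G)"
    using assms unfolding sum_Pow_Diff[of ?f, symmetric]
    by (intro sum.cong refl) (simp add: row_sum_def pm_adj_complement sum_negf)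
  then have m: "Pow_mean ?A ?f = 0" by (simp add: Pow_mean_def sum_negf)
  have e: "(\<Sum>e\<in>?A. (max 0 (?f G - ?f (flip e G)))\<^sup>2) \<le> 8 * real n" for G
  proof -
    have "(\<Sum>e\<in>?A. (max 0 (?f G - ?f (flip e G)))\<^sup>2)
       \<le> (\<Sum>a<n. \<Sum>b<n. (if a = i then 4 else 0) + (if b = i then 4 else 0))"
      by (intro sum_all_pairs_le) (auto simp: row_sum_flip max_def power_mult_distrib pm_adj_sq)
    also have "\<dots> = 8 * real n"
      using assms by (simp add: sum.distrib sum_distrib_left[symmetric])
    finally show ?thesis .
  qed
  have "(\<Sum>G\<in>Pow ?A. (?f G)\<^sup>2) \<le> (\<Sum>G\<in>Pow ?A. \<Sum>e\<in>?A. (max 0 (?f G - ?f (flip e G)))\<^sup>2) / 2"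
    using variance_Pow_le[of ?A ?f] by (simp add: m)
  also have "\<dots> \<le> (\<Sum>G\<in>Pow ?A. 8 * real n) / 2"
    by (intro divide_right_mono sum_mono e) simp
  finally show ?thesis by (simp add: card_Pow mult_ac)
qed

text \<open>The sum is \<open>|X 1|\<^sup>2\<close>, of mean at most \<open>4 * n\<^sup>2\<close>.
  The squared decreases under single flips add up to \<open>O(n)\<close> times the sum itself, so
  the variance is \<open>O(n\<^sup>3)\<close>, and Chebyshev at distance \<open>n\<^sup>2\<close>
  from the mean leaves \<open>O(1/n)\<close>.\<close>

lemma prob_row_sums_large:
  assumes n: "n > 0"
  shows "measure_pmf.prob (gnp_half n) {G. (\<Sum>i<n. (row_sum n G i)\<^sup>2) \<ge> 5 * (real n)\<^sup>2} \<le> 128 / real n"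
proof -
  let ?A = "all_pairs n"
  let ?f = "\<lambda>G. \<Sum>i<n. (row_sum n G i)\<^sup>2"
  have tot: "(\<Sum>G\<in>Pow ?A. ?f G) \<le> 2 ^ card ?A * (4 * (real n)\<^sup>2)"
  proof -
    have "(\<Sum>G\<in>Pow ?A. ?f G) = (\<Sum>i<n. \<Sum>G\<in>Pow ?A. (row_sum n G i)\<^sup>2)"
      by (rule sum.swap)
    also have "\<dots> \<le> (\<Sum>i<n. 2 ^ card ?A * (4 * real n))"
      by (intro sum_mono row_sum_second_moment) auto
    finally show ?thesis by (simp add: power2_eq_square mult_ac)
  qed
  have m: "Pow_mean ?A ?f \<le> 4 * (real n)\<^sup>2"
    using tot by (simp add: Pow_mean_def field_simps)
  have e: "(\<Sum>e\<in>?A. (max 0 (?f G - ?f (flip e G)))\<^sup>2) \<le> 64 * real n * ?f G" for G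
  proof -
    have "(\<Sum>e\<in>?A. (max 0 (?f G - ?f (flip e G)))\<^sup>2)
       \<le> (\<Sum>i<n. \<Sum>j<n. 32 * (row_sum n G i)\<^sup>2 + 32 * (row_sum n G j)\<^sup>2)"
    proof (intro sum_all_pairs_le)
      fix i j assume ij: "i < n" "j < n" "i \<noteq> j"
      let ?x = "pm_adj G i j" and ?r = "row_sum n G"
      have x2: "?x\<^sup>2 = 1" using ij by (simp add: pm_adj_sq)
      have "?f G - ?f (flip {i, j} G) = (\<Sum>a<n. (if a = i then 4 * ?x * ?r i - 4 else 0)
          + (if a = j then 4 * ?x * ?r j - 4 else 0))"
        unfolding sum_subtractf[symmetric]
        using ij x2 by (intro sum.cong refl)
           (auto simp: row_sum_flip power2_diff power_mult_distrib)
      also have "\<dots> = 4 * ?x * (?r i + ?r j) - 8"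
        using ij by (simp add: sum.distrib algebra_simps)
      \<comment> \<open>The term -8 may be dropped because only decreases are measured.\<close>
      also have "\<dots> \<le> \<bar>4 * ?x * (?r i + ?r j)\<bar>" by linarith
      finally have "max 0 (?f G - ?f (flip {i, j} G)) \<le> \<bar>4 * ?x * (?r i + ?r j)\<bar>" by simp
      then have "(max 0 (?f G - ?f (flip {i, j} G)))\<^sup>2 \<le> \<bar>4 * ?x * (?r i + ?r j)\<bar>\<^sup>2"
        by (intro power_mono) auto
      also have "\<dots> = 16 * (?r i + ?r j)\<^sup>2" by (simp add: power_mult_distrib x2)
      also have "\<dots> \<le> 32 * (?r i)\<^sup>2 + 32 * (?r j)\<^sup>2"
        using zero_le_power2[of "?r i - ?r j"] by (simp add: power2_eq_square algebra_simps)
      finally show "(max 0 (?f G - ?f (flip {i, j} G)))\<^sup>2 \<le> 32 * (?r i)\<^sup>2 + 32 * (?r j)\<^sup>2" .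
    qed auto
    also have "\<dots> = 64 * real n * ?f G"
      by (simp add: sum.distrib sum_distrib_left[symmetric])
    finally show ?thesis .
  qed
  have "(\<Sum>G\<in>Pow ?A. (?f G - Pow_mean ?A ?f)\<^sup>2)
      \<le> (\<Sum>G\<in>Pow ?A. \<Sum>e\<in>?A. (max 0 (?f G - ?f (flip e G)))\<^sup>2) / 2"
    by (intro variance_Pow_le) simp
  also have "\<dots> \<le> (\<Sum>G\<in>Pow ?A. 64 * real n * ?f G) / 2"
    by (intro divide_right_mono sum_mono e) simp
  also have "\<dots> = 32 * real n * (\<Sum>G\<in>Pow ?A. ?f G)"
    by (simp add: sum_distrib_left[symmetric])
  also have "\<dots> \<le> 32 * real n * (2 ^ card ?A * (4 * (real n)\<^sup>2))"
    by (intro mult_left_mono tot) auto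
  finally have V: "(\<Sum>G\<in>Pow ?A. (?f G - Pow_mean ?A ?f)\<^sup>2) \<le> 2 ^ card ?A * (128 * real n ^ 3)"
    by (simp add: power2_eq_square power3_eq_cube mult_ac)
  have "measure_pmf.prob (gnp_half n) {G. ?f G \<ge> 5 * (real n)\<^sup>2}
     \<le> measure_pmf.prob (gnp_half n) {G. \<bar>?f G - Pow_mean ?A ?f\<bar> \<ge> (real n)\<^sup>2}"
    using m by (intro measure_pmf.finite_measure_mono) auto
  also have "\<dots> \<le> 128 * real n ^ 3 / ((real n)\<^sup>2)\<^sup>2"
    using n by (intro chebyshev_gnp_half V) auto
  also have "\<dots> = 128 / real n" using n by (simp add: power2_eq_square power3_eq_cube)
  finally show ?thesis .
qed

section \<open>Concentration of the truncated energy\<close>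

text \<open>Only the quadratic form is constrained and \<open>S\<close> may be nonsymmetric, so the
  flip bounds carry both \<open>S i j\<close> and \<open>S j i\<close>.\<close>

definition psd :: "nat \<Rightarrow> (nat \<Rightarrow> nat \<Rightarrow> real) \<Rightarrow> bool" where
  "psd n S \<longleftrightarrow> (\<forall>v. 0 \<le> (\<Sum>i<n. \<Sum>j<n. v i * S i j * v j))"

text \<open>This is \<open>|X - s I|\<^sup>2 - |X - s I - S|\<^sup>2\<close> in Frobenius norms, so
  maximising it projects \<open>X - s I\<close> onto the positive semidefinite cone.\<close>

definition pos_objective :: "nat \<Rightarrow> real \<Rightarrow> (nat \<Rightarrow> nat \<Rightarrow> real) \<Rightarrow> (nat \<Rightarrow> nat \<Rightarrow> real) \<Rightarrow> real" where
  "pos_objective n s X S =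
     2 * (\<Sum>i<n. \<Sum>j<n. X i j * S i j) - 2 * s * (\<Sum>i<n. S i i) - (\<Sum>i<n. \<Sum>j<n. (S i j)\<^sup>2)"

text \<open>A supremum instead of a sum over eigenvalues makes this a function of the matrix alone,
  and two matrices can be compared through a common \<open>S\<close> without eigenvalue
  perturbation.\<close>

definition pos_energy :: "nat \<Rightarrow> real \<Rightarrow> (nat \<Rightarrow> nat \<Rightarrow> real) \<Rightarrow> real" where
  "pos_energy n s X = (SUP S\<in>{S. psd n S}. pos_objective n s X S)"

lemma psd_zero: "psd n (\<lambda>i j. 0)"
  by (simp add: psd_def)

lemma psd_diag_nonneg:
  assumes "psd n S" "i < n"
  shows "0 \<le> S i i"
proof -
  have "0 \<le> (\<Sum>a<n. \<Sum>b<n. (if a = i then 1 else 0) * S a b * (if b = i then 1 else 0))"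
    using assms(1) unfolding psd_def by (rule spec)
  also have "\<dots> = (\<Sum>a<n. if a = i then S i i else 0)"
    using assms(2) by (intro sum.cong refl) (simp add: if_distrib cong: if_cong)
  also have "\<dots> = S i i" using assms(2) by simp
  finally show ?thesis .
qed

lemma psd_trace_nonneg: "psd n S \<Longrightarrow> 0 \<le> (\<Sum>i<n. S i i)"
  by (intro sum_nonneg) (auto intro: psd_diag_nonneg)

text \<open>The weighted inequality \<open>2 x y \<le> 2 x\<^sup>2 + y\<^sup>2 / 2\<close> keeps
  half of \<open>|S|\<^sup>2\<close>, so the bound also limits the norm of a nearly optimal
  \<open>S\<close>.\<close>

lemma pos_objective_le:
  assumes "psd n S" "0 \<le> s"
  shows "pos_objective n s X S \<le>
    2 * (\<Sum>i<n. \<Sum>j<n. (X i j)\<^sup>2) - (\<Sum>i<n. \<Sum>j<n. (S i j)\<^sup>2) / 2"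
proof -
  have "2 * (\<Sum>i<n. \<Sum>j<n. X i j * S i j) \<le> (\<Sum>i<n. \<Sum>j<n. 2 * (X i j)\<^sup>2 + (S i j)\<^sup>2 / 2)"
    unfolding sum_distrib_left
  proof (intro sum_mono)
    fix i j
    show "2 * (X i j * S i j) \<le> 2 * (X i j)\<^sup>2 + (S i j)\<^sup>2 / 2"
      using zero_le_power2[of "2 * X i j - S i j"] by (simp add: power2_eq_square algebra_simps)
  qed
  also have "\<dots> = 2 * (\<Sum>i<n. \<Sum>j<n. (X i j)\<^sup>2) + (\<Sum>i<n. \<Sum>j<n. (S i j)\<^sup>2) / 2"
    by (simp add: sum.distrib sum_distrib_left sum_divide_distrib)
  finally have "2 * (\<Sum>i<n. \<Sum>j<n. X i j * S i j) \<le> \<dots>" .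
  moreover have "0 \<le> 2 * s * (\<Sum>i<n. S i i)"
    using psd_trace_nonneg[OF assms(1)] assms(2) by simp
  ultimately show ?thesis unfolding pos_objective_def by linarith
qed

lemma bdd_above_pos_objective:
  assumes "0 \<le> s"
  shows "bdd_above (pos_objective n s X ` {S. psd n S})"
proof (rule bdd_aboveI2)
  fix S assume "S \<in> {S. psd n S}"
  then have "pos_objective n s X S \<le>
    2 * (\<Sum>i<n. \<Sum>j<n. (X i j)\<^sup>2) - (\<Sum>i<n. \<Sum>j<n. (S i j)\<^sup>2) / 2"
    using pos_objective_le assms by simp
  moreover have "0 \<le> (\<Sum>i<n. \<Sum>j<n. (S i j)\<^sup>2)"
    by (intro sum_nonneg) auto
  ultimately show "pos_objective n s X S \<le> 2 * (\<Sum>i<n. \<Sum>j<n. (X i j)\<^sup>2)" by linarith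
qed

lemma pos_objective_le_energy:
  "0 \<le> s \<Longrightarrow> psd n S \<Longrightarrow> pos_objective n s X S \<le> pos_energy n s X"
  unfolding pos_energy_def by (intro cSUP_upper bdd_above_pos_objective) auto

text \<open>Freezing a nearly optimal \<open>S\<close> for \<open>G\<close> bounds the decrease of the supremum under every
  single flip at once by a linear function of the entries of \<open>S\<close>.\<close>

lemma pos_energy_flips:
  assumes s: "0 \<le> s" and n: "n > 0"
  shows "(\<Sum>e\<in>all_pairs n. (max 0 (pos_energy n s (pm_adj G) - pos_energy n s (pm_adj (flip e G))))\<^sup>2)
    \<le> 600 * (real n)\<^sup>2"
proof -
  let ?X = "pm_adj G"
  let ?f = "\<lambda>G. pos_energy n s (pm_adj G)"
  \<comment> \<open>The slack 1 avoids the question whether the supremum is attained; it adds only a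
    constant to each flip difference.\<close>
  have "?f G - 1 < (SUP S\<in>{S. psd n S}. pos_objective n s ?X S)"
    by (simp add: pos_energy_def)
  then obtain S where S: "psd n S" "?f G - 1 < pos_objective n s ?X S"
    using less_cSUP_iff[OF _ bdd_above_pos_objective[OF s], of n "?f G - 1" ?X] psd_zero by blast
  \<comment> \<open>The zero matrix has value 0, so the chosen \<open>S\<close> has value at least
    -1, which caps \<open>|S|\<^sup>2\<close>.\<close>
  have "0 \<le> ?f G"
    using pos_objective_le_energy[OF s psd_zero, of n ?X] by (simp add: pos_objective_def)
  then have "- 1 \<le> 2 * (\<Sum>i<n. \<Sum>j<n. (?X i j)\<^sup>2) - (\<Sum>i<n. \<Sum>j<n. (S i j)\<^sup>2) / 2"
    using S pos_objective_le[OF S(1) s, of ?X] by linarith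
  moreover have "(\<Sum>i<n. \<Sum>j<n. (?X i j)\<^sup>2) \<le> (\<Sum>i<n. \<Sum>j<n. 1)"
    by (intro sum_mono) (simp add: pm_adj_sq)
  ultimately have S2: "(\<Sum>i<n. \<Sum>j<n. (S i j)\<^sup>2) \<le> 4 * (real n)\<^sup>2 + 2"
    by (simp add: power2_eq_square)
  have "(\<Sum>e\<in>all_pairs n. (max 0 (?f G - ?f (flip e G)))\<^sup>2)
     \<le> (\<Sum>i<n. \<Sum>j<n. 48 * (S i j)\<^sup>2 + 48 * (S j i)\<^sup>2 + 3)"
  proof (intro sum_all_pairs_le)
    fix i j assume ij: "i < n" "j < n" "i \<noteq> j"
    let ?Y = "pm_adj (flip {i, j} G)" and ?x = "pm_adj G i j"
    have "?f G - ?f (flip {i, j} G) \<le> pos_objective n s ?X S + 1 - pos_objective n s ?Y S"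
      using S pos_objective_le_energy[OF s S(1), of ?Y] by linarith
    also have "\<dots> = 2 * (\<Sum>a<n. \<Sum>b<n. (?X a b - ?Y a b) * S a b) + 1"
      by (simp add: pos_objective_def left_diff_distrib sum_subtractf)
    also have "(\<Sum>a<n. \<Sum>b<n. (?X a b - ?Y a b) * S a b)
      = (\<Sum>a<n. (if a = i then 2 * ?x * S i j else 0) + (if a = j then 2 * ?x * S j i else 0))"
      using ij unfolding pm_adj_flip[OF ij(3)]
      by (intro sum.cong refl) (auto simp: if_distrib[of "\<lambda>z. z * _"] cong: if_cong)
    also have "\<dots> = 2 * (?x * (S i j + S j i))"
      using ij by (simp add: sum.distrib algebra_simps)
    also have "2 * (2 * (?x * (S i j + S j i))) + 1 \<le> 4 * \<bar>S i j\<bar> + 4 * \<bar>S j i\<bar> + 1"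
    proof -
      have "?x * (S i j + S j i) \<le> \<bar>?x\<bar> * \<bar>S i j + S j i\<bar>"
        by (simp add: abs_mult[symmetric])
      also have "\<dots> \<le> 1 * \<bar>S i j + S j i\<bar>" by (intro mult_right_mono abs_pm_adj_le) simp
      also have "\<dots> \<le> \<bar>S i j\<bar> + \<bar>S j i\<bar>" by simp
      finally show ?thesis by simp
    qed
    finally have "max 0 (?f G - ?f (flip {i, j} G)) \<le> 4 * \<bar>S i j\<bar> + 4 * \<bar>S j i\<bar> + 1"
      by simp
    then have "(max 0 (?f G - ?f (flip {i, j} G)))\<^sup>2 \<le> (4 * \<bar>S i j\<bar> + 4 * \<bar>S j i\<bar> + 1)\<^sup>2"
      by (intro power_mono) auto
    also have "\<dots> \<le> 3 * ((4 * \<bar>S i j\<bar>)\<^sup>2 + (4 * \<bar>S j i\<bar>)\<^sup>2 + 1\<^sup>2)"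
    proof -
      have "(x + y + z)\<^sup>2 \<le> 3 * (x\<^sup>2 + y\<^sup>2 + z\<^sup>2)" for x y z :: real
        using zero_le_power2[of "x - y"] zero_le_power2[of "y - z"] zero_le_power2[of "x - z"]
        by (simp add: power2_eq_square algebra_simps)
      then show ?thesis .
    qed
    finally show "(max 0 (?f G - ?f (flip {i, j} G)))\<^sup>2 \<le> 48 * (S i j)\<^sup>2 + 48 * (S j i)\<^sup>2 + 3"
      by (simp add: power_mult_distrib)
  qed auto
  also have "\<dots> = 48 * (\<Sum>i<n. \<Sum>j<n. (S i j)\<^sup>2) + 48 * (\<Sum>i<n. \<Sum>j<n. (S j i)\<^sup>2) + 3 * (real n)\<^sup>2"
    by (simp add: sum.distrib sum_distrib_left power2_eq_square)
  also have "(\<Sum>i<n. \<Sum>j<n. (S j i)\<^sup>2) = (\<Sum>i<n. \<Sum>j<n. (S i j)\<^sup>2)"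
    by (rule sum.swap)
  also have "48 * (\<Sum>i<n. \<Sum>j<n. (S i j)\<^sup>2) + 48 * (\<Sum>i<n. \<Sum>j<n. (S i j)\<^sup>2) + 3 * (real n)\<^sup>2
     \<le> 387 * (real n)\<^sup>2 + 192" using S2 by linarith
  also have "\<dots> \<le> 600 * (real n)\<^sup>2"
  proof -
    have "1 \<le> (real n)\<^sup>2" using n by (simp add: one_le_power)
    then show ?thesis by simp
  qed
  finally show ?thesis .
qed

lemma pos_energy_variance:
  assumes "0 \<le> s" "n > 0"
  shows "(\<Sum>G\<in>Pow (all_pairs n). (pos_energy n s (pm_adj G)
            - Pow_mean (all_pairs n) (\<lambda>G. pos_energy n s (pm_adj G)))\<^sup>2)
     \<le> 2 ^ card (all_pairs n) * (300 * (real n)\<^sup>2)"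
proof -
  let ?A = "all_pairs n" and ?f = "\<lambda>G. pos_energy n s (pm_adj G)"
  have "(\<Sum>G\<in>Pow ?A. (?f G - Pow_mean ?A ?f)\<^sup>2)
      \<le> (\<Sum>G\<in>Pow ?A. \<Sum>e\<in>?A. (max 0 (?f G - ?f (flip e G)))\<^sup>2) / 2"
    by (intro variance_Pow_le) simp
  also have "\<dots> \<le> (\<Sum>G\<in>Pow ?A. 600 * (real n)\<^sup>2) / 2"
    by (intro divide_right_mono sum_mono pos_energy_flips assms) simp
  finally show ?thesis by (simp add: card_Pow mult_ac)
qed

text \<open>Complementation negates the matrix, so both energies have the same mean and the difference
  concentrates around zero.\<close>

lemma prob_energy_gap:
  assumes s: "0 \<le> s" and n: "n > 0"
  shows "measure_pmf.prob (gnp_half n)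
    {G. \<bar>pos_energy n s (pm_adj G) - pos_energy n s (pm_adj (all_pairs n - G))\<bar>
          \<ge> 2 * real n powr (3/2)} \<le> 600 / real n"
proof -
  let ?A = "all_pairs n" and ?f = "\<lambda>G. pos_energy n s (pm_adj G)"
  let ?t = "real n powr (3/2)" and ?\<mu> = "Pow_mean (all_pairs n) (\<lambda>G. pos_energy n s (pm_adj G))"
  let ?P = "measure_pmf.prob (gnp_half n)"
  have t: "?t > 0" using n by simp
  \<comment> \<open>Against the variance bound \<open>300 * n\<^sup>2\<close> this leaves
    \<open>300 / n\<close> for each of the two energies.\<close>
  have t2: "?t\<^sup>2 = real n ^ 3"
    unfolding power2_eq_square powr_add[symmetric] using n by simp
  have V1: "(\<Sum>G\<in>Pow ?A. (?f G - ?\<mu>)\<^sup>2) \<le> 2 ^ card ?A * (300 * (real n)\<^sup>2)"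
    by (rule pos_energy_variance[OF s n])
  have V2: "(\<Sum>G\<in>Pow ?A. (?f (?A - G) - ?\<mu>)\<^sup>2) \<le> 2 ^ card ?A * (300 * (real n)\<^sup>2)"
    using V1 unfolding sum_Pow_Diff[of "\<lambda>G. (?f G - ?\<mu>)\<^sup>2"] .
  have "?P {G. \<bar>?f G - ?f (?A - G)\<bar> \<ge> 2 * ?t}
     \<le> ?P ({G. \<bar>?f G - ?\<mu>\<bar> \<ge> ?t} \<union> {G. \<bar>?f (?A - G) - ?\<mu>\<bar> \<ge> ?t})"
    by (intro measure_pmf.finite_measure_mono) auto
  also have "\<dots> \<le> ?P {G. \<bar>?f G - ?\<mu>\<bar> \<ge> ?t} + ?P {G. \<bar>?f (?A - G) - ?\<mu>\<bar> \<ge> ?t}"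
    by (intro measure_Un_le) auto
  also have "\<dots> \<le> 300 * (real n)\<^sup>2 / ?t\<^sup>2 + 300 * (real n)\<^sup>2 / ?t\<^sup>2"
    by (intro add_mono chebyshev_gnp_half V1 V2 t)
  also have "\<dots> = 600 / real n"
    using n unfolding t2 by (simp add: power2_eq_square power3_eq_cube)
  finally show ?thesis .
qed

section \<open>The energy of the upper half of a balanced spectrum\<close>

text \<open>The contribution of an eigenvalue \<open>x\<close> to
  \<open>P\<^sub>s - N\<^sub>s\<close>; for \<open>s = 0\<close> it is
  \<open>x * \<bar>x\<bar>\<close>.\<close>

definition odd_sq :: "real \<Rightarrow> real \<Rightarrow> real" where
  "odd_sq s x = (max 0 (x - s))\<^sup>2 - (max 0 (- x - s))\<^sup>2"

lemma odd_sq_minus: "odd_sq s (- x) = - odd_sq s x"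
  by (simp add: odd_sq_def)

text \<open>The second difference in the threshold is a smoothed step in \<open>x\<close>: it is
  \<open>x\<^sup>2\<close> up to \<open>s\<close> and saturates at \<open>2 * s\<^sup>2\<close> from
  \<open>2 * s\<close> on. Saturation makes all large eigenvalues count equally, whatever their
  size.\<close>

lemma second_difference_nonneg:
  assumes "0 \<le> s" "0 \<le> x"
  shows "0 \<le> odd_sq 0 x - 2 * odd_sq s x + odd_sq (2 * s) x"
    and "odd_sq 0 x - 2 * odd_sq s x + odd_sq (2 * s) x \<le> 2 * s\<^sup>2"
    and "2 * s \<le> x \<Longrightarrow> odd_sq 0 x - 2 * odd_sq s x + odd_sq (2 * s) x = 2 * s\<^sup>2"
proof -
  let ?K = "odd_sq 0 x - 2 * odd_sq s x + odd_sq (2 * s) x"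
  consider "x \<le> s" | "s \<le> x" "x \<le> 2 * s" | "2 * s \<le> x" by linarith
  then have *: "0 \<le> ?K \<and> ?K \<le> 2 * s\<^sup>2"
  proof cases
    case 1
    then have "?K = x\<^sup>2" using assms by (simp add: odd_sq_def)
    moreover have "x\<^sup>2 \<le> s\<^sup>2" using 1 assms by (intro power_mono)
    ultimately show ?thesis by (smt (verit) zero_le_power2)
  next
    case 2
    then have K: "?K = x\<^sup>2 - 2 * (x - s)\<^sup>2" using assms by (simp add: odd_sq_def)
    have "(x - s)\<^sup>2 \<le> s\<^sup>2" "s\<^sup>2 \<le> x\<^sup>2" using 2 assms by (intro power_mono; simp)+
    \<comment> \<open>This form yields both bounds, as \<open>(2 * s - x)\<^sup>2\<close> lies
      between 0 and \<open>s\<^sup>2\<close> here.\<close>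
    moreover have "x\<^sup>2 - 2 * (x - s)\<^sup>2 = 2 * s\<^sup>2 - (2 * s - x)\<^sup>2"
      by (simp add: power2_eq_square algebra_simps)
    moreover have "(2 * s - x)\<^sup>2 \<le> s\<^sup>2" using 2 assms by (intro power_mono) auto
    ultimately show ?thesis unfolding K using zero_le_power2[of "2 * s - x"] zero_le_power2[of s] by linarith
  next
    case 3
    then show ?thesis using assms
      by (simp add: odd_sq_def power2_eq_square algebra_simps)
  qed
  then show "0 \<le> ?K" "?K \<le> 2 * s\<^sup>2" by auto
  show "?K = 2 * s\<^sup>2" if "2 * s \<le> x"
    using that assms by (simp add: odd_sq_def power2_eq_square algebra_simps)
qed

text \<open>By oddness a negative \<open>x\<close> gives minus the value at \<open>- x\<close>,
  which is at most \<open>2 * s\<^sup>2\<close>.\<close>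

lemma second_difference_ge:
  assumes "0 \<le> s"
  shows "- (2 * s\<^sup>2) \<le> odd_sq 0 x - 2 * odd_sq s x + odd_sq (2 * s) x"
proof (cases "0 \<le> x")
  case True
  then show ?thesis using second_difference_nonneg(1)[OF assms True] by (smt (verit) zero_le_power2)
next
  case False
  then show ?thesis using second_difference_nonneg(2)[OF assms, of "- x"] by (simp add: odd_sq_minus)
qed

lemma sum_split_half:
  fixes f :: "nat \<Rightarrow> real"
  assumes "n = 2 * h"
  shows "(\<Sum>k<n. f k) = (\<Sum>k<h. f k) + (\<Sum>k=h..<n. f k)"
  using assms by (subst sum.union_disjoint[symmetric]) (auto intro!: sum.cong)

text \<open>If the median \<open>t\<close> is positive, the upper half of the spectrum contributes exactly \<open>2 s\<^sup>2\<close> each to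
  the sum of the second differences for \<open>2 s \<le> t\<close>, and the lower half at least \<open>- 2 s\<^sup>2\<close>. An
  eigenvalue of the lower half that lies in \<open>(0, t]\<close> leaves a surplus \<open>2 s\<^sup>2\<close>, comparable to its square.\<close>

lemma top_half_energy_pos:
  fixes lam :: "nat \<Rightarrow> real"
  assumes nh: "n = 2 * h" "h > 0"
    and mono: "\<And>k l. k \<le> l \<Longrightarrow> l < n \<Longrightarrow> lam l \<le> lam k"
    and pos: "0 < lam h"
    and tot: "(\<Sum>k<n. (lam k)\<^sup>2) \<le> (real n)\<^sup>2" and L: "real n \<le> 2 ^ L"
    and gap0: "\<bar>\<Sum>k<n. odd_sq 0 (lam k)\<bar> \<le> Q"
    and gap: "\<And>j. j \<le> L \<Longrightarrow> \<bar>\<Sum>k<n. odd_sq (2 ^ j) (lam k)\<bar> \<le> Q"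
  shows "\<bar>2 * (\<Sum>k<h. (lam k)\<^sup>2) - (\<Sum>k<n. (lam k)\<^sup>2)\<bar> \<le> 65 * Q + 4 * real n"
proof -
  let ?t = "lam h"
  \<comment> \<open>The energy of the positive eigenvalues in the lower half. The imbalance is the
    signed energy at threshold 0 minus \<open>2 * R\<close>, hence 65 = 1 + 2 * 32 in the
    claim.\<close>
  define R where "R = (\<Sum>k=h..<n. (max 0 (lam k))\<^sup>2)"
  have up: "?t \<le> lam k" if "k < h" for k using that nh by (intro mono) auto
  have dn: "lam k \<le> ?t" if "k \<in> {h..<n}" for k using that nh by (intro mono) auto
  have Q: "0 \<le> Q" using gap0 by linarith
  have R: "R \<le> 2 * real n + 32 * Q"
  \<comment> \<open>Below 2 no scale \<open>s \<ge> 1\<close> has \<open>2 * s \<le> ?t\<close>;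
    there \<open>R\<close> is bounded trivially by 4 for each of the \<open>n / 2\<close>
    terms.\<close>
  proof (cases "?t < 2")
    case True
    have "R \<le> (\<Sum>k=h..<n. 4)"
      unfolding R_def
    proof (rule sum_mono)
      fix k assume "k \<in> {h..<n}"
      then have "(max 0 (lam k))\<^sup>2 \<le> 2\<^sup>2" using dn[of k] True by (intro power_mono) auto
      then show "(max 0 (lam k))\<^sup>2 \<le> 4" by simp
    qed
    also have "\<dots> = 2 * real n" using nh by simp
    finally show ?thesis using Q by simp
  next
    case False
    \<comment> \<open>The \<open>h\<close> upper eigenvalues are at least \<open>?t\<close>, so the
      total energy forces \<open>?t \<le> n\<close>; this keeps the scale within the range up to
      \<open>2 ^ L\<close>.\<close>
    have "real h * ?t\<^sup>2 = (\<Sum>k<h. ?t\<^sup>2)" by simp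
    also have "\<dots> \<le> (\<Sum>k<h. (lam k)\<^sup>2)" using up pos by (intro sum_mono power_mono) auto
    also have "\<dots> \<le> (\<Sum>k<n. (lam k)\<^sup>2)" using nh by (intro sum_mono2) auto
    also have "\<dots> \<le> (real n)\<^sup>2" by (rule tot)
    finally have "real h * ?t\<^sup>2 \<le> real h * (2 * real n)" using nh by (simp add: power2_eq_square)
    then have "?t\<^sup>2 \<le> 2 * real n" using nh by simp
    moreover have "2 * ?t \<le> ?t\<^sup>2" using False by (simp add: power2_eq_square)
    ultimately have tL: "?t \<le> 2 ^ L" using L by linarith
    obtain m where m: "2 ^ m \<le> ?t" "?t < 2 ^ Suc m"
    proof -
      define p where "p = (LEAST p. ?t < 2 ^ p)"
      have p: "?t < 2 ^ p"
        unfolding p_def by (rule LeastI_ex) (rule real_arch_pow, simp)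
      then have "p \<noteq> 0" using False by (intro notI) simp
      then obtain m where m: "p = Suc m" by (cases p) auto
      have "\<not> ?t < 2 ^ m" using not_less_Least[of m "\<lambda>p. ?t < 2 ^ p"] m by (simp add: p_def)
      then show ?thesis using that[of m] p m by simp
    qed
    have "m \<noteq> 0" using m(2) False by (intro notI) simp
    then obtain j where mj: "m = Suc j" by (cases m) auto
    \<comment> \<open>\<open>2 * s\<close> is the largest power of two not exceeding
      \<open>?t\<close>. Since \<open>?t \<ge> 2\<close>, both \<open>s\<close> and
      \<open>2 * s\<close> are among the thresholds with a controlled gap.\<close>
    define s :: real where "s = 2 ^ j"
    have s: "0 < s" "2 * s \<le> ?t" "?t \<le> 4 * s" using m by (auto simp: s_def mj)
    have "(2::real) ^ m \<le> 2 ^ L" using m(1) tL by linarith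
    then have jL: "m \<le> L" by simp
    have s2: "2 * s = 2 ^ m" by (simp add: s_def mj)
    let ?K = "\<lambda>x. odd_sq 0 x - 2 * odd_sq s x + odd_sq (2 * s) x"
    have "(\<Sum>k<n. ?K (lam k)) = (\<Sum>k<n. odd_sq 0 (lam k)) - 2 * (\<Sum>k<n. odd_sq s (lam k))
        + (\<Sum>k<n. odd_sq (2 * s) (lam k))"
      by (simp add: sum.distrib sum_subtractf sum_distrib_left)
    moreover have "\<bar>\<Sum>k<n. odd_sq s (lam k)\<bar> \<le> Q" "\<bar>\<Sum>k<n. odd_sq (2 * s) (lam k)\<bar> \<le> Q"
      unfolding s2 using gap[of j] gap[of m] jL by (auto simp: s_def mj)
    ultimately have "(\<Sum>k<n. ?K (lam k)) \<le> 4 * Q" using gap0 by linarith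
    moreover have "(\<Sum>k<n. ?K (lam k)) \<ge> (\<Sum>k<h. 2 * s\<^sup>2) + (\<Sum>k=h..<n. (max 0 (lam k))\<^sup>2 / 8 - 2 * s\<^sup>2)"
      unfolding sum_split_half[OF nh(1)]
    proof (intro add_mono sum_mono)
      fix k assume "k \<in> {..<h}"
      then show "2 * s\<^sup>2 \<le> ?K (lam k)"
        using up[of k] s second_difference_nonneg(3)[of s "lam k"] by simp
    next
      fix k assume k: "k \<in> {h..<n}"
      show "(max 0 (lam k))\<^sup>2 / 8 - 2 * s\<^sup>2 \<le> ?K (lam k)"
      proof (cases "0 \<le> lam k")
        case True
        \<comment> \<open>The square is at most \<open>16 * s\<^sup>2\<close>, so an eighth of it is
          covered by the surplus \<open>2 * s\<^sup>2\<close>.\<close>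
        have "(lam k)\<^sup>2 \<le> (4 * s)\<^sup>2" using True dn[OF k] s by (intro power_mono) auto
        then show ?thesis using True second_difference_nonneg(1)[of s "lam k"] s
          by (simp add: power_mult_distrib)
      next
        case False
        then show ?thesis using second_difference_ge[of s "lam k"] s by simp
      qed
    qed
    \<comment> \<open>Both halves have \<open>h\<close> elements, so the terms
      \<open>2 * s\<^sup>2\<close> cancel and \<open>R / 8 \<le> 4 * Q\<close> remains.\<close>
    moreover have "(\<Sum>k<h. 2 * s\<^sup>2) + (\<Sum>k=h..<n. (max 0 (lam k))\<^sup>2 / 8 - 2 * s\<^sup>2) = R / 8"
      using nh by (simp add: R_def sum_subtractf sum_divide_distrib)
    ultimately show ?thesis by simp
  qed
  have R0: "0 \<le> R" unfolding R_def by (intro sum_nonneg) auto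
  have "2 * (\<Sum>k<h. (lam k)\<^sup>2) - (\<Sum>k<n. (lam k)\<^sup>2) = (\<Sum>k<n. odd_sq 0 (lam k)) - 2 * R"
  proof -
    have "(\<Sum>k<h. odd_sq 0 (lam k)) = (\<Sum>k<h. (lam k)\<^sup>2)"
    proof (rule sum.cong[OF refl])
      fix k assume "k \<in> {..<h}"
      then show "odd_sq 0 (lam k) = (lam k)\<^sup>2" using up[of k] pos by (simp add: odd_sq_def)
    qed
    moreover have "(\<Sum>k=h..<n. odd_sq 0 (lam k)) = (\<Sum>k=h..<n. 2 * (max 0 (lam k))\<^sup>2 - (lam k)\<^sup>2)"
      by (intro sum.cong refl) (auto simp: odd_sq_def max_def)
    ultimately show ?thesis unfolding sum_split_half[OF nh(1)]
      by (simp add: R_def sum_subtractf sum_distrib_left)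
  qed
  then show ?thesis using R R0 gap0 by linarith
qed

text \<open>The two middle eigenvalues are \<open>lam (h - 1)\<close> and \<open>lam h\<close>. If
  the first is negative, negating and reversing the spectrum swaps the halves and reduces to a
  positive median. If they enclose 0, the halves split by sign and the imbalance is exactly the
  signed energy at threshold 0.\<close>

lemma top_half_energy:
  fixes lam :: "nat \<Rightarrow> real"
  assumes nh: "n = 2 * h" "h > 0"
    and mono: "\<And>k l. k \<le> l \<Longrightarrow> l < n \<Longrightarrow> lam l \<le> lam k"
    and tot: "(\<Sum>k<n. (lam k)\<^sup>2) \<le> (real n)\<^sup>2" and L: "real n \<le> 2 ^ L"
    and gap0: "\<bar>\<Sum>k<n. odd_sq 0 (lam k)\<bar> \<le> Q"
    and gap: "\<And>j. j \<le> L \<Longrightarrow> \<bar>\<Sum>k<n. odd_sq (2 ^ j) (lam k)\<bar> \<le> Q"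
  shows "\<bar>2 * (\<Sum>k<h. (lam k)\<^sup>2) - (\<Sum>k<n. (lam k)\<^sup>2)\<bar> \<le> 65 * Q + 4 * real n"
proof -
  consider "0 < lam h" | "lam (h - 1) < 0" | "lam h \<le> 0" "0 \<le> lam (h - 1)" by linarith
  then show ?thesis
  proof cases
    case 1
    then show ?thesis using top_half_energy_pos[OF nh mono _ tot L gap0 gap] by blast
  next
    case 2
    define lam' where "lam' k = - lam (n - 1 - k)" for k
    have rev: "(\<Sum>k<n. f (lam' k)) = (\<Sum>k<n. f (- lam k))" for f :: "real \<Rightarrow> real"
      unfolding lam'_def using sum.nat_diff_reindex[of "\<lambda>k. f (- lam k)" n] by simp
    have "\<bar>2 * (\<Sum>k<h. (lam' k)\<^sup>2) - (\<Sum>k<n. (lam' k)\<^sup>2)\<bar> \<le> 65 * Q + 4 * real n"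
    proof (rule top_half_energy_pos[OF nh])
      show "lam' l \<le> lam' k" if "k \<le> l" "l < n" for k l
        unfolding lam'_def using that mono[of "n - 1 - l" "n - 1 - k"] by simp
      have "n - 1 - h = h - 1" using nh by simp
      then show "0 < lam' h" using 2 by (simp add: lam'_def)
      show "(\<Sum>k<n. (lam' k)\<^sup>2) \<le> (real n)\<^sup>2" unfolding rev[of "\<lambda>x. x\<^sup>2"] using tot by simp
      show "real n \<le> 2 ^ L" by (rule L)
      show "\<bar>\<Sum>k<n. odd_sq 0 (lam' k)\<bar> \<le> Q"
        unfolding rev odd_sq_minus sum_negf using gap0 by simp
      show "\<bar>\<Sum>k<n. odd_sq (2 ^ j) (lam' k)\<bar> \<le> Q" if "j \<le> L" for j
        unfolding rev odd_sq_minus sum_negf using gap[OF that] by simp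
    qed
    moreover have "(\<Sum>k<h. (lam' k)\<^sup>2) = (\<Sum>k=h..<n. (lam k)\<^sup>2)"
      unfolding lam'_def using nh
      by (intro sum.reindex_bij_witness[of _ "\<lambda>k. n - 1 - k" "\<lambda>k. n - 1 - k"]) auto
    ultimately show ?thesis
      unfolding rev[of "\<lambda>x. x\<^sup>2"] sum_split_half[OF nh(1)] by simp
  next
    case 3
    have "(\<Sum>k<h. (lam k)\<^sup>2) = (\<Sum>k<h. odd_sq 0 (lam k))"
    proof (rule sum.cong[OF refl])
      fix k assume "k \<in> {..<h}"
      then have "k \<le> h - 1" "h - 1 < n" using nh by auto
      then have "0 \<le> lam k" using mono[of k "h - 1"] 3(2) by linarith
      then show "(lam k)\<^sup>2 = odd_sq 0 (lam k)" by (simp add: odd_sq_def)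
    qed
    moreover have "(\<Sum>k=h..<n. (lam k)\<^sup>2) = (\<Sum>k=h..<n. - odd_sq 0 (lam k))"
    proof (rule sum.cong[OF refl])
      fix k assume "k \<in> {h..<n}"
      then have "lam k \<le> 0" using mono[of h k] 3 by simp
      then show "(lam k)\<^sup>2 = - odd_sq 0 (lam k)" by (simp add: odd_sq_def)
    qed
    ultimately have "2 * (\<Sum>k<h. (lam k)\<^sup>2) - (\<Sum>k<n. (lam k)\<^sup>2) = (\<Sum>k<n. odd_sq 0 (lam k))"
      unfolding sum_split_half[OF nh(1)] by (simp add: sum_negf)
    then show ?thesis using gap0 by linarith
  qed
qed

section \<open>Spectral decompositions\<close>

definition orthonormal :: "nat \<Rightarrow> (nat \<Rightarrow> nat \<Rightarrow> real) \<Rightarrow> bool" where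
  "orthonormal n u \<longleftrightarrow> (\<forall>k<n. \<forall>l<n. (\<Sum>i<n. u k i * u l i) = (if k = l then 1 else 0))"

text \<open>Parseval's identity. Restricting one factor to \<open>I\<close> lets a part of the
  spectrum be paired with the whole of it.\<close>

lemma sum_mult_sum_orthonormal:
  assumes o: "orthonormal n u" and I: "I \<subseteq> {..<n}"
  shows "(\<Sum>i<n. (\<Sum>k\<in>I. c k * u k i) * (\<Sum>l<n. d l * u l i)) = (\<Sum>k\<in>I. c k * d k)"
proof -
  have "(\<Sum>i<n. (\<Sum>k\<in>I. c k * u k i) * (\<Sum>l<n. d l * u l i))
     = (\<Sum>i<n. \<Sum>k\<in>I. \<Sum>l<n. c k * d l * (u k i * u l i))"
    unfolding sum_product by (intro sum.cong refl) (simp add: mult_ac)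
  also have "\<dots> = (\<Sum>k\<in>I. \<Sum>i<n. \<Sum>l<n. c k * d l * (u k i * u l i))"
    by (rule sum.swap)
  also have "\<dots> = (\<Sum>k\<in>I. \<Sum>l<n. c k * d l * (\<Sum>i<n. u k i * u l i))"
    unfolding sum_distrib_left by (intro sum.cong refl sum.swap)
  also have "\<dots> = (\<Sum>k\<in>I. \<Sum>l<n. if l = k then c k * d k else 0)"
    using o I unfolding orthonormal_def by (intro sum.cong refl) (auto simp: subset_iff)
  also have "\<dots> = (\<Sum>k\<in>I. c k * d k)"
    using I by (intro sum.cong refl) (auto simp: subset_iff)
  finally show ?thesis .
qed

lemma frobenius_orthonormal:
  assumes o: "orthonormal n u" and I: "I \<subseteq> {..<n}"
  shows "(\<Sum>i<n. \<Sum>j<n. (\<Sum>k\<in>I. c k * u k i * u k j) * (\<Sum>l<n. d l * u l i * u l j))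
     = (\<Sum>k\<in>I. c k * d k)"
proof -
  have "(\<Sum>i<n. \<Sum>j<n. (\<Sum>k\<in>I. c k * u k i * u k j) * (\<Sum>l<n. d l * u l i * u l j))
     = (\<Sum>i<n. \<Sum>k\<in>I. c k * u k i * (d k * u k i))"
    by (intro sum.cong refl sum_mult_sum_orthonormal[OF o I])
  also have "\<dots> = (\<Sum>k\<in>I. \<Sum>i<n. c k * u k i * (d k * u k i))" by (rule sum.swap)
  also have "\<dots> = (\<Sum>k\<in>I. c k * d k * (\<Sum>i<n. u k i * u k i))"
    by (simp add: sum_distrib_left mult_ac)
  also have "\<dots> = (\<Sum>k\<in>I. c k * d k)"
    using o I unfolding orthonormal_def by (intro sum.cong refl) (auto simp: subset_iff)
  finally show ?thesis .
qed

lemma trace_orthonormal: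
  assumes o: "orthonormal n u" and I: "I \<subseteq> {..<n}"
  shows "(\<Sum>i<n. \<Sum>k\<in>I. c k * u k i * u k i) = (\<Sum>k\<in>I. c k)"
proof -
  have "(\<Sum>i<n. \<Sum>k\<in>I. c k * u k i * u k i) = (\<Sum>k\<in>I. c k * (\<Sum>i<n. u k i * u k i))"
    unfolding sum_distrib_left by (subst sum.swap) (simp add: mult_ac)
  also have "\<dots> = (\<Sum>k\<in>I. c k)"
    using o I unfolding orthonormal_def by (intro sum.cong refl) (auto simp: subset_iff)
  finally show ?thesis .
qed

text \<open>The projection \<open>P\<close> onto the span has \<open>|P|\<^sup>2 = tr P = n\<close>, hence \<open>|1 - P|\<^sup>2 = n - 2 n + n = 0\<close>.\<close>

lemma orthonormal_complete:
  assumes o: "orthonormal n u" and ij: "i < n" "j < n"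
  shows "(\<Sum>k<n. u k i * u k j) = (if i = j then 1 else 0)"
proof -
  let ?P = "\<lambda>i j. \<Sum>k<n. u k i * u k j"
  let ?d = "\<lambda>i j::nat. if i = j then 1 else (0::real)"
  have PP: "(\<Sum>i<n. \<Sum>j<n. ?P i j * ?P i j) = real n"
    using frobenius_orthonormal[OF o, of "{..<n}" "\<lambda>_. 1" "\<lambda>_. 1"] by simp
  have tr: "(\<Sum>i<n. ?P i i) = real n"
    using trace_orthonormal[OF o, of "{..<n}" "\<lambda>_. 1"] by simp
  have "(\<Sum>i<n. \<Sum>j<n. (?P i j - ?d i j)\<^sup>2)
     = (\<Sum>i<n. \<Sum>j<n. ?P i j * ?P i j) + (\<Sum>i<n. \<Sum>j<n. if j = i then 1 - 2 * ?P i i else 0)"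
    unfolding sum.distrib[symmetric]
    by (intro sum.cong refl) (auto simp: power2_eq_square algebra_simps)
  also have "(\<Sum>i<n. \<Sum>j<n. if j = i then 1 - 2 * ?P i i else 0) = (\<Sum>i<n. 1 - 2 * ?P i i)"
    by (intro sum.cong refl) simp
  also have "\<dots> = - real n"
    using tr by (simp add: sum_subtractf sum_distrib_left[symmetric])
  finally have "(\<Sum>i<n. \<Sum>j<n. (?P i j - ?d i j)\<^sup>2) = 0" using PP by simp
  then have "\<forall>i\<in>{..<n}. (\<Sum>j<n. (?P i j - ?d i j)\<^sup>2) = 0"
    by (subst (asm) sum_nonneg_eq_0_iff) (auto intro: sum_nonneg)
  then have "(\<Sum>j<n. (?P i j - ?d i j)\<^sup>2) = 0" using ij by simp
  then have "\<forall>j\<in>{..<n}. (?P i j - ?d i j)\<^sup>2 = 0"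
    by (subst (asm) sum_nonneg_eq_0_iff) auto
  then show ?thesis using ij by simp
qed

text \<open>By completeness the trace may be computed in the basis \<open>u\<close>. For the
  constant matrix 1 this is Parseval for the all-ones vector.\<close>

lemma sum_quadratic_forms_eq_trace:
  assumes o: "orthonormal n u"
  shows "(\<Sum>k<n. \<Sum>i<n. \<Sum>j<n. u k i * S i j * u k j) = (\<Sum>i<n. S i i)"
proof -
  have "(\<Sum>k<n. \<Sum>i<n. \<Sum>j<n. u k i * S i j * u k j) = (\<Sum>i<n. \<Sum>j<n. \<Sum>k<n. u k i * S i j * u k j)"
    by (subst sum.swap) (intro sum.cong refl sum.swap)
  also have "\<dots> = (\<Sum>i<n. \<Sum>j<n. S i j * (\<Sum>k<n. u k i * u k j))"
    by (simp add: sum_distrib_left mult_ac)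
  also have "\<dots> = (\<Sum>i<n. \<Sum>j<n. if j = i then S i i else 0)"
    using orthonormal_complete[OF o] by (intro sum.cong refl) auto
  also have "\<dots> = (\<Sum>i<n. S i i)" by (intro sum.cong refl) auto
  finally show ?thesis .
qed

lemma frobenius_eq_quadratic_forms:
  "(\<Sum>i<n. \<Sum>j<n. (\<Sum>k<n. c k * u k i * u k j) * S i j)
     = (\<Sum>k<n. c k * (\<Sum>i<n. \<Sum>j<n. u k i * S i j * u k (j::nat)))" for c :: "nat \<Rightarrow> real"
proof -
  have "(\<Sum>i<n. \<Sum>j<n. (\<Sum>k<n. c k * u k i * u k j) * S i j)
      = (\<Sum>i<n. \<Sum>j<n. \<Sum>k<n. c k * (u k i * S i j * u k j))"
    by (simp add: sum_distrib_right sum_distrib_left mult_ac)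
  also have "\<dots> = (\<Sum>k<n. \<Sum>i<n. \<Sum>j<n. c k * (u k i * S i j * u k j))"
    by (subst sum.swap, subst (2) sum.swap, subst sum.swap) (intro sum.cong refl sum.swap)
  finally show ?thesis by (simp add: sum_distrib_left)
qed

text \<open>The maximiser is \<open>T\<close>, the positive part of \<open>X - s I\<close>. For any
  other \<open>S\<close> the forms \<open>q S k\<close> are nonnegative, so \<open>lam k - s\<close>
  may be raised to \<open>d k\<close>, and \<open>|S - T|\<^sup>2 \<ge> 0\<close> then gives the
  upper bound.\<close>

lemma pos_energy_spectral:
  assumes o: "orthonormal n u" and s: "0 \<le> s"
    and X: "\<And>i j. i < n \<Longrightarrow> j < n \<Longrightarrow> X i j = (\<Sum>k<n. lam k * u k i * u k j)"
  shows "pos_energy n s X = (\<Sum>k<n. (max 0 (lam k - s))\<^sup>2)"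
proof -
  define d where "d k = max 0 (lam k - s)" for k
  define T where "T i j = (\<Sum>k<n. d k * u k i * u k j)" for i j
  define q where "q S k = (\<Sum>i<n. \<Sum>j<n. u k i * S i j * u k j)" for S k
  have obj: "pos_objective n s X S = 2 * (\<Sum>k<n. (lam k - s) * q S k) - (\<Sum>i<n. \<Sum>j<n. (S i j)\<^sup>2)" for S
  proof -
    have "(\<Sum>i<n. \<Sum>j<n. X i j * S i j) = (\<Sum>i<n. \<Sum>j<n. (\<Sum>k<n. lam k * u k i * u k j) * S i j)"
      by (intro sum.cong refl) (simp add: X)
    also have "\<dots> = (\<Sum>k<n. lam k * q S k)"
      unfolding q_def by (rule frobenius_eq_quadratic_forms)
    finally show ?thesis
      unfolding pos_objective_def sum_quadratic_forms_eq_trace[OF o, symmetric] q_def[symmetric]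
      by (simp add: left_diff_distrib sum_subtractf sum_distrib_left[symmetric])
  qed
  have TS: "(\<Sum>i<n. \<Sum>j<n. T i j * S i j) = (\<Sum>k<n. d k * q S k)" for S
    unfolding T_def q_def by (rule frobenius_eq_quadratic_forms)
  have TT: "(\<Sum>i<n. \<Sum>j<n. (T i j)\<^sup>2) = (\<Sum>k<n. (d k)\<^sup>2)"
    unfolding T_def power2_eq_square by (rule frobenius_orthonormal[OF o]) simp
  have qT: "q T k = d k" if "k < n" for k
  proof -
    \<comment> \<open>The quadratic form is the Frobenius product of \<open>T\<close> with the
      projection onto \<open>u k\<close>.\<close>
    have "q T k = (\<Sum>i<n. \<Sum>j<n. (\<Sum>l\<in>{k}. 1 * u l i * u l j) * (\<Sum>l<n. d l * u l i * u l j))"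
      unfolding q_def T_def by (simp add: mult_ac)
    also have "\<dots> = (\<Sum>l\<in>{k}. 1 * d l)"
      by (rule frobenius_orthonormal[OF o]) (use that in simp)
    finally show ?thesis by simp
  qed
  have psdT: "psd n T"
    unfolding psd_def
  proof
    fix v
    have "(\<Sum>i<n. \<Sum>j<n. v i * T i j * v j) = (\<Sum>i<n. \<Sum>j<n. T i j * (v i * v j))"
      by (simp add: mult_ac)
    also have "\<dots> = (\<Sum>k<n. d k * q (\<lambda>i j. v i * v j) k)" by (rule TS)
    also have "\<dots> = (\<Sum>k<n. d k * (\<Sum>i<n. u k i * v i)\<^sup>2)"
      unfolding q_def power2_eq_square sum_product by (simp add: mult_ac)
    also have "\<dots> \<ge> 0" by (intro sum_nonneg mult_nonneg_nonneg) (auto simp: d_def)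
    finally show "0 \<le> (\<Sum>i<n. \<Sum>j<n. v i * T i j * v j)" .
  qed
  have "pos_objective n s X T = 2 * (\<Sum>k<n. (lam k - s) * d k) - (\<Sum>k<n. (d k)\<^sup>2)"
    unfolding obj TT using qT by simp
  also have "(\<Sum>k<n. (lam k - s) * d k) = (\<Sum>k<n. (d k)\<^sup>2)"
    by (intro sum.cong refl) (auto simp: d_def max_def power2_eq_square)
  finally have ge: "(\<Sum>k<n. (d k)\<^sup>2) \<le> pos_energy n s X"
    using pos_objective_le_energy[OF s psdT, of X] by simp
  have "pos_objective n s X S \<le> (\<Sum>k<n. (d k)\<^sup>2)" if S: "psd n S" for S
  proof -
    have "0 \<le> (\<Sum>i<n. \<Sum>j<n. (S i j - T i j)\<^sup>2)" by (intro sum_nonneg) auto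
    also have "\<dots> = (\<Sum>i<n. \<Sum>j<n. (S i j)\<^sup>2) - 2 * (\<Sum>i<n. \<Sum>j<n. T i j * S i j) + (\<Sum>i<n. \<Sum>j<n. (T i j)\<^sup>2)"
      by (simp add: power2_diff sum.distrib sum_subtractf sum_distrib_left mult_ac)
    finally have "2 * (\<Sum>k<n. d k * q S k) - (\<Sum>i<n. \<Sum>j<n. (S i j)\<^sup>2) \<le> (\<Sum>k<n. (d k)\<^sup>2)"
      unfolding TS TT by simp
    moreover have "(\<Sum>k<n. (lam k - s) * q S k) \<le> (\<Sum>k<n. d k * q S k)"
      using S by (intro sum_mono mult_right_mono) (auto simp: d_def q_def psd_def)
    ultimately show ?thesis unfolding obj by linarith
  qed
  then have "pos_energy n s X \<le> (\<Sum>k<n. (d k)\<^sup>2)"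
    unfolding pos_energy_def using psd_zero by (intro cSUP_least) auto
  then show ?thesis using ge unfolding d_def by simp
qed

text \<open>The basis \<open>u\<close> also diagonalises the negated matrix of the complement, with
  eigenvalues \<open>- lam k\<close>.\<close>

lemma energy_gap_spectral:
  assumes o: "orthonormal n u" and s: "0 \<le> s"
    and X: "\<And>i j. i < n \<Longrightarrow> j < n \<Longrightarrow> pm_adj G i j = (\<Sum>k<n. lam k * u k i * u k j)"
  shows "pos_energy n s (pm_adj G) - pos_energy n s (pm_adj (all_pairs n - G))
     = (\<Sum>k<n. odd_sq s (lam k))"
proof -
  have "pos_energy n s (pm_adj (all_pairs n - G)) = (\<Sum>k<n. (max 0 (- lam k - s))\<^sup>2)"
    by (rule pos_energy_spectral[OF o s]) (simp add: pm_adj_complement X sum_negf)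
  moreover have "pos_energy n s (pm_adj G) = (\<Sum>k<n. (max 0 (lam k - s))\<^sup>2)"
    by (rule pos_energy_spectral[OF o s X])
  ultimately show ?thesis by (simp add: odd_sq_def sum_subtractf)
qed

section \<open>Averages over edges and non-edges\<close>

text \<open>The indicator of an edge at \<open>(i, j)\<close> is half of 1 minus the identity entry
  plus \<open>pm_adj G i j\<close>.\<close>

lemma sum_edge_pairs:
  "(\<Sum>(i, j)\<in>edge_pairs n G. M i j) =
     ((\<Sum>i<n. \<Sum>j<n. M i j) - (\<Sum>i<n. M i i) + (\<Sum>i<n. \<Sum>j<n. M i j * pm_adj G i j)) / 2"
proof -
  have sub: "edge_pairs n G \<subseteq> {..<n} \<times> {..<n}" by (auto simp: edge_pairs_def)
  have "(\<Sum>(i, j)\<in>edge_pairs n G. M i j)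
      = (\<Sum>p\<in>{..<n} \<times> {..<n}. if p \<in> edge_pairs n G then M (fst p) (snd p) else 0)"
    using sub by (subst sum.inter_restrict[symmetric]) (auto simp: Int_absorb1 case_prod_unfold)
  also have "\<dots> = (\<Sum>i<n. \<Sum>j<n. if (i, j) \<in> edge_pairs n G then M i j else 0)"
    by (simp add: sum.cartesian_product case_prod_unfold)
  also have "\<dots> = (\<Sum>i<n. \<Sum>j<n. (M i j - (if j = i then M i i else 0) + M i j * pm_adj G i j) / 2)"
    by (intro sum.cong refl) (auto simp: edge_pairs_def pm_adj_def)
  also have "\<dots> = ((\<Sum>i<n. \<Sum>j<n. M i j) - (\<Sum>i<n. \<Sum>j<n. if j = i then M i i else 0)
      + (\<Sum>i<n. \<Sum>j<n. M i j * pm_adj G i j)) / 2"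
    by (simp add: sum.distrib sum_subtractf sum_divide_distrib[symmetric])
  also have "(\<Sum>i<n. \<Sum>j<n. if j = i then M i i else 0) = (\<Sum>i<n. M i i)"
    by (intro sum.cong refl) auto
  finally show ?thesis .
qed

text \<open>The diagonal belongs to the non-edges, hence the plus sign of the trace.\<close>

lemma sum_nonedge_pairs:
  "(\<Sum>(i, j)\<in>nonedge_pairs n G. M i j) =
     ((\<Sum>i<n. \<Sum>j<n. M i j) + (\<Sum>i<n. M i i) - (\<Sum>i<n. \<Sum>j<n. M i j * pm_adj G i j)) / (2::real)"
proof -
  have sub: "edge_pairs n G \<subseteq> {..<n} \<times> {..<n}" by (auto simp: edge_pairs_def)
  have "(\<Sum>(i, j)\<in>nonedge_pairs n G. M i j)
     = (\<Sum>(i, j)\<in>{..<n} \<times> {..<n}. M i j) - (\<Sum>(i, j)\<in>edge_pairs n G. M i j)"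
    unfolding nonedge_pairs_def using sub by (intro sum_diff) auto
  also have "(\<Sum>(i, j)\<in>{..<n} \<times> {..<n}. M i j) = (\<Sum>i<n. \<Sum>j<n. M i j)"
    by (simp add: sum.cartesian_product)
  finally show ?thesis unfolding sum_edge_pairs by (simp add: field_simps)
qed

text \<open>Here \<open>r\<close> stands for the square root of \<open>n\<close>: a numerator error
  of order \<open>n powr (3/2)\<close> is divided by a number of pairs of order
  \<open>n\<^sup>2\<close>.\<close>

lemma abs_avg_diff_le:
  fixes T c B q :: real
  assumes "\<bar>T - q * c\<bar> \<le> 8 * B * r ^ 3" "c \<ge> r ^ 4 / 8" "r > 0"
  shows "\<bar>T / c - q\<bar> \<le> 64 * B / r"
proof -
  have r4: "r ^ 4 > 0" using assms(3) by simp
  then have c: "c > 0" using assms(2) by linarith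
  have "\<bar>T / c - q\<bar> = \<bar>T - q * c\<bar> / c"
  proof -
    have "T / c - q = (T - q * c) / c" using c by (simp add: diff_divide_distrib)
    then show ?thesis using c by simp
  qed
  also have "\<dots> \<le> 8 * B * r ^ 3 / c"
    using c assms(1) by (intro divide_right_mono) auto
  also have "\<dots> \<le> 8 * B * r ^ 3 / (r ^ 4 / 8)"
  proof (rule divide_left_mono)
    show "0 \<le> 8 * B * r ^ 3" using assms(1) by linarith
    show "0 < c * (r ^ 4 / 8)" using c r4 by simp
  qed (rule assms(2))
  also have "\<dots> = 64 * B / r" using assms(3) by (simp add: eval_nat_numeral)
  finally show ?thesis .
qed

lemma sum_eigenvalues_sq:
  assumes o: "orthonormal n u"
    and X: "\<And>i j. i < n \<Longrightarrow> j < n \<Longrightarrow> pm_adj G i j = (\<Sum>k<n. lam k * u k i * u k j)"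
  shows "(\<Sum>k<n. (lam k)\<^sup>2) = (real n)\<^sup>2 - real n"
proof -
  have "(\<Sum>k<n. (lam k)\<^sup>2)
     = (\<Sum>i<n. \<Sum>j<n. (\<Sum>k<n. lam k * u k i * u k j) * (\<Sum>k<n. lam k * u k i * u k j))"
    unfolding power2_eq_square by (rule frobenius_orthonormal[OF o, symmetric]) simp
  also have "\<dots> = (\<Sum>i<n. \<Sum>j<n. (pm_adj G i j)\<^sup>2)"
    unfolding power2_eq_square by (intro sum.cong refl) (simp add: X)
  also have "\<dots> = (\<Sum>i<n. \<Sum>j<n. 1 - (if j = i then 1 else 0))"
    by (intro sum.cong refl) (simp add: pm_adj_sq)
  also have "\<dots> = (real n)\<^sup>2 - real n"
    by (simp add: sum_subtractf power2_eq_square algebra_simps)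
  finally show ?thesis .
qed

lemma spectral_averages:
  fixes lam :: "nat \<Rightarrow> real"
  assumes o: "orthonormal n u"
    and X: "\<And>i j. i < n \<Longrightarrow> j < n \<Longrightarrow> pm_adj G i j = (\<Sum>k<n. lam k * u k i * u k j)"
    and rows: "(\<Sum>i<n. (row_sum n G i)\<^sup>2) \<le> 5 * (real n)\<^sup>2"
    and I: "I \<subseteq> {..<n}"
    and half: "\<bar>2 * (\<Sum>k\<in>I. (lam k)\<^sup>2) - (\<Sum>k<n. (lam k)\<^sup>2)\<bar> \<le> B * sqrt n ^ 3"
    and n: "n \<ge> 100"
    and M: "M = (\<lambda>i j. \<Sum>k\<in>I. lam k * u k i * u k j)"
  shows "\<bar>avg_over (edge_pairs n G) M - 1/2\<bar> \<le> 64 * (B + 10) / sqrt n"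
    and "\<bar>avg_over (nonedge_pairs n G) M + 1/2\<bar> \<le> 64 * (B + 10) / sqrt n"
proof -
  define r where "r = sqrt (real n)"
  have r10: "10 \<le> r" unfolding r_def using n by (intro real_le_rsqrt) auto
  have nr: "real n = r\<^sup>2" by (simp add: r_def)
  \<comment> \<open>The coordinates of the all-ones vector in the basis \<open>u\<close>; those of
    the row sum vector are \<open>lam k * b k\<close>.\<close>
  define b where "b k = (\<Sum>i<n. u k i)" for k
  have tot: "(\<Sum>k<n. (lam k)\<^sup>2) = r ^ 4 - r\<^sup>2"
    using sum_eigenvalues_sq[OF o X] by (simp add: nr power_mult[symmetric])
  have rowb: "(\<Sum>k<n. (lam k * b k)\<^sup>2) \<le> 5 * r ^ 4"
  proof -
    have "row_sum n G i = (\<Sum>k<n. lam k * b k * u k i)" if "i < n" for i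
      unfolding row_sum_def b_def sum_distrib_left sum_distrib_right using that
      by (subst sum.swap) (auto intro!: sum.cong simp: X mult_ac)
    then have "(\<Sum>i<n. (row_sum n G i)\<^sup>2) = (\<Sum>i<n. (\<Sum>k<n. lam k * b k * u k i) * (\<Sum>k<n. lam k * b k * u k i))"
      by (simp add: power2_eq_square)
    also have "\<dots> = (\<Sum>k<n. (lam k * b k)\<^sup>2)"
      unfolding power2_eq_square by (rule sum_mult_sum_orthonormal[OF o]) simp
    finally show ?thesis using rows unfolding nr by (simp add: power_mult[symmetric])
  qed
  have bb: "(\<Sum>k<n. (b k)\<^sup>2) = r\<^sup>2"
    using sum_quadratic_forms_eq_trace[OF o, of "\<lambda>_ _. 1"]
    by (simp add: b_def power2_eq_square sum_product nr)
  \<comment> \<open>Used with \<open>J = I\<close> for the sum of \<open>M\<close>, and with the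
    full index set for the sum of the adjacency matrix, which fixes the number of edges.\<close>
  have quad: "\<bar>\<Sum>i<n. \<Sum>j<n. \<Sum>k\<in>J. lam k * u k i * u k j\<bar> \<le> 3 * r ^ 3" if J: "J \<subseteq> {..<n}" for J
  proof -
    have "(\<Sum>i<n. \<Sum>j<n. \<Sum>k\<in>J. lam k * u k i * u k j) = (\<Sum>i<n. \<Sum>k\<in>J. \<Sum>j<n. lam k * u k i * u k j)"
      by (intro sum.cong refl sum.swap)
    also have "\<dots> = (\<Sum>k\<in>J. \<Sum>i<n. \<Sum>j<n. lam k * u k i * u k j)" by (rule sum.swap)
    also have "\<dots> = (\<Sum>k\<in>J. lam k * b k * b k)"
    proof (rule sum.cong[OF refl])
      fix k
      have "b k * b k = (\<Sum>i<n. \<Sum>j<n. u k i * u k j)" unfolding b_def by (rule sum_product)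
      then show "(\<Sum>i<n. \<Sum>j<n. lam k * u k i * u k j) = lam k * b k * b k"
        by (simp add: mult.assoc sum_distrib_left)
    qed
    finally have eq: "(\<Sum>i<n. \<Sum>j<n. \<Sum>k\<in>J. lam k * u k i * u k j) = (\<Sum>k\<in>J. lam k * b k * b k)" .
    have "(\<Sum>k\<in>J. lam k * b k * b k)\<^sup>2 \<le> (\<Sum>k\<in>J. (lam k * b k)\<^sup>2) * (\<Sum>k\<in>J. (b k)\<^sup>2)"
      by (rule Cauchy_Schwarz_ineq_sum)
    also have "\<dots> \<le> (\<Sum>k<n. (lam k * b k)\<^sup>2) * (\<Sum>k<n. (b k)\<^sup>2)"
      using J by (intro mult_mono sum_mono2) (auto intro: sum_nonneg)
    \<comment> \<open>The 5 is rounded up to 9 to obtain a perfect square.\<close>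
    also have "\<dots> \<le> 9 * r ^ 4 * r\<^sup>2"
    proof -
      have "0 \<le> r ^ 4" using r10 by simp
      then have "(\<Sum>k<n. (lam k * b k)\<^sup>2) \<le> 9 * r ^ 4" using rowb by linarith
      then show ?thesis unfolding bb by (rule mult_right_mono) simp
    qed
    also have "\<dots> = (3 * r ^ 3)\<^sup>2" by (simp add: power_mult_distrib eval_nat_numeral)
    finally have "\<bar>\<Sum>k\<in>J. lam k * b k * b k\<bar> \<le> \<bar>3 * r ^ 3\<bar>" by (simp only: abs_le_square_iff)
    then show ?thesis unfolding eq using r10 by simp
  qed
  have tr: "\<bar>\<Sum>i<n. M i i\<bar> \<le> r ^ 3"
  proof -
    have "(\<Sum>i<n. M i i) = (\<Sum>k\<in>I. lam k)"
      unfolding M by (rule trace_orthonormal[OF o I])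
    moreover have "\<bar>\<Sum>k\<in>I. lam k\<bar> \<le> \<bar>r ^ 3\<bar>"
    proof -
      have "(\<Sum>k\<in>I. lam k * 1)\<^sup>2 \<le> (\<Sum>k\<in>I. (lam k)\<^sup>2) * (\<Sum>k\<in>I. 1\<^sup>2)"
        by (rule Cauchy_Schwarz_ineq_sum)
      also have "\<dots> \<le> (\<Sum>k<n. (lam k)\<^sup>2) * (\<Sum>k<n. 1\<^sup>2)"
        using I by (intro mult_mono sum_mono2) (auto intro: sum_nonneg)
      also have "\<dots> \<le> r ^ 4 * r\<^sup>2"
        unfolding tot by (simp add: nr algebra_simps)
      also have "\<dots> = (r ^ 3)\<^sup>2" by (simp add: eval_nat_numeral)
      finally show ?thesis unfolding abs_le_square_iff by (simp only: mult_1_right)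
    qed
    ultimately show ?thesis using r10 by simp
  qed
  have fr: "(\<Sum>i<n. \<Sum>j<n. M i j * pm_adj G i j) = (\<Sum>k\<in>I. (lam k)\<^sup>2)"
  proof -
    have "(\<Sum>i<n. \<Sum>j<n. M i j * pm_adj G i j)
       = (\<Sum>i<n. \<Sum>j<n. (\<Sum>k\<in>I. lam k * u k i * u k j) * (\<Sum>k<n. lam k * u k i * u k j))"
      unfolding M by (intro sum.cong refl) (simp add: X)
    also have "\<dots> = (\<Sum>k\<in>I. (lam k)\<^sup>2)"
      unfolding power2_eq_square by (rule frobenius_orthonormal[OF o I])
    finally show ?thesis .
  qed
  define S where "S = (\<Sum>i<n. \<Sum>j<n. M i j)"
  define XX where "XX = (\<Sum>i<n. \<Sum>j<n. pm_adj G i j)"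
  have Sb: "\<bar>S\<bar> \<le> 3 * r ^ 3" unfolding S_def M by (rule quad[OF I])
  have XXb: "\<bar>XX\<bar> \<le> 3 * r ^ 3"
    using quad[of "{..<n}"] unfolding XX_def by (simp add: X)
  have cE: "real (card (edge_pairs n G)) = (r ^ 4 - r\<^sup>2 + XX) / 2"
    using sum_edge_pairs[of "\<lambda>_ _. 1" n G] by (simp add: XX_def nr eval_nat_numeral mult_ac)
  have cN: "real (card (nonedge_pairs n G)) = (r ^ 4 + r\<^sup>2 - XX) / 2"
    using sum_nonedge_pairs[of "\<lambda>_ _. 1" n G] by (simp add: XX_def nr eval_nat_numeral mult_ac)
  have r23: "r\<^sup>2 \<le> r ^ 3" using r10 by (intro power_increasing) auto
  have r34: "10 * r ^ 3 \<le> r ^ 4"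
    using r10 by (simp add: eval_nat_numeral mult_right_mono)
  have r2: "0 \<le> r\<^sup>2" by simp
  have half': "\<bar>2 * (\<Sum>k\<in>I. (lam k)\<^sup>2) - (r ^ 4 - r\<^sup>2)\<bar> \<le> B * r ^ 3"
    using half unfolding tot r_def .
  have sE: "(\<Sum>(i, j)\<in>edge_pairs n G. M i j) = (S - (\<Sum>i<n. M i i) + (\<Sum>k\<in>I. (lam k)\<^sup>2)) / 2"
    unfolding sum_edge_pairs fr S_def ..
  have sN: "(\<Sum>(i, j)\<in>nonedge_pairs n G. M i j) = (S + (\<Sum>i<n. M i i) - (\<Sum>k\<in>I. (lam k)\<^sup>2)) / 2"
    unfolding sum_nonedge_pairs fr S_def ..
  have ex: "8 * (B + 10) * r ^ 3 = 8 * (B * r ^ 3) + 80 * r ^ 3" by (simp add: algebra_simps)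
  have B0: "0 \<le> B * r ^ 3" using half' by linarith
  show "\<bar>avg_over (edge_pairs n G) M - 1/2\<bar> \<le> 64 * (B + 10) / sqrt n"
    unfolding avg_over_def r_def[symmetric]
  proof (rule abs_avg_diff_le)
    show "\<bar>(\<Sum>(i, j)\<in>edge_pairs n G. M i j) - 1 / 2 * real (card (edge_pairs n G))\<bar> \<le> 8 * (B + 10) * r ^ 3"
      unfolding cE sE ex abs_le_iff using half' Sb XXb tr r23 r2 B0
      unfolding abs_le_iff by (intro conjI) argo+
    show "r ^ 4 / 8 \<le> real (card (edge_pairs n G))"
      unfolding cE using XXb[unfolded abs_le_iff] r23 r34 r2 by argo
    show "0 < r" using r10 by simp
  qed
  have "\<bar>avg_over (nonedge_pairs n G) M - (- 1/2)\<bar> \<le> 64 * (B + 10) / sqrt n"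
    unfolding avg_over_def r_def[symmetric]
  proof (rule abs_avg_diff_le)
    show "\<bar>(\<Sum>(i, j)\<in>nonedge_pairs n G. M i j) - (- 1 / 2) * real (card (nonedge_pairs n G))\<bar> \<le> 8 * (B + 10) * r ^ 3"
      unfolding cN sN ex abs_le_iff using half' Sb XXb tr r23 r2 B0
      unfolding abs_le_iff by (intro conjI) argo+
    show "r ^ 4 / 8 \<le> real (card (nonedge_pairs n G))"
      unfolding cN using XXb[unfolded abs_le_iff] r23 r34 r2 by argo
    show "0 < r" using r10 by simp
  qed
  then show "\<bar>avg_over (nonedge_pairs n G) M + 1/2\<bar> \<le> 64 * (B + 10) / sqrt n" by simp
qed

text \<open>The deterministic half of the argument: row sums and energy gaps control every spectral
  decomposition of \<open>G\<close>. The constants are 134 = 65 * 2 + 4 and 9216 = 64 * (134 +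
  10).\<close>

lemma half_spectrum_averages:
  assumes sd: "is_spectral_decomp n (pm_adj G) lam u" and n: "even n" "n \<ge> 100"
    and rows: "(\<Sum>i<n. (row_sum n G i)\<^sup>2) < 5 * (real n)\<^sup>2" and L: "real n \<le> 2 ^ L"
    and gap: "\<And>s. s \<in> insert 0 ((\<lambda>j. 2 ^ j) ` {..L}) \<Longrightarrow>
       \<bar>pos_energy n s (pm_adj G) - pos_energy n s (pm_adj (all_pairs n - G))\<bar> < 2 * real n powr (3/2)"
    and M: "M = part_plus n lam u \<or> M = part_minus n lam u"
  shows "\<bar>avg_over (edge_pairs n G) M - 1/2\<bar> \<le> 9216 / sqrt n"
    and "\<bar>avg_over (nonedge_pairs n G) M + 1/2\<bar> \<le> 9216 / sqrt n"
proof -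
  define h where "h = n div 2"
  have nh: "n = 2 * h" "h > 0" using n by (auto simp: h_def)
  have o: "orthonormal n u" using sd by (simp add: is_spectral_decomp_def orthonormal_def)
  have X: "pm_adj G i j = (\<Sum>k<n. lam k * u k i * u k j)" if "i < n" "j < n" for i j
    using sd that by (simp add: is_spectral_decomp_def)
  have mono: "lam l \<le> lam k" if "k \<le> l" "l < n" for k l
    using sd that by (simp add: is_spectral_decomp_def)
  have p: "real n powr (3/2) = sqrt n ^ 3"
  proof -
    have "sqrt n ^ 3 = real n * sqrt n" by (simp add: power3_eq_cube)
    also have "\<dots> = real n powr 1 * real n powr (1/2)" using n by (simp add: powr_half_sqrt)
    also have "\<dots> = real n powr (3/2)" unfolding powr_add[symmetric] by simp
    finally show ?thesis ..
  qed
  have Q: "\<bar>\<Sum>k<n. odd_sq s (lam k)\<bar> \<le> 2 * sqrt n ^ 3" if s: "s \<in> insert 0 ((\<lambda>j. 2 ^ j) ` {..L})" for s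
  proof -
    have "0 \<le> s" using s by auto
    then show ?thesis using gap[OF s] energy_gap_spectral[OF o _ X] unfolding p by simp
  qed
  have tot: "(\<Sum>k<n. (lam k)\<^sup>2) \<le> (real n)\<^sup>2"
    using sum_eigenvalues_sq[OF o X] by simp
  have "\<bar>2 * (\<Sum>k<h. (lam k)\<^sup>2) - (\<Sum>k<n. (lam k)\<^sup>2)\<bar> \<le> 65 * (2 * sqrt n ^ 3) + 4 * real n"
    using Q by (intro top_half_energy[OF nh mono tot L]) auto
  moreover have "real n \<le> sqrt n ^ 3" using n by (simp add: power3_eq_cube)
  ultimately have up: "\<bar>2 * (\<Sum>k<h. (lam k)\<^sup>2) - (\<Sum>k<n. (lam k)\<^sup>2)\<bar> \<le> 134 * sqrt n ^ 3" by simp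
  then have dn: "\<bar>2 * (\<Sum>k=h..<n. (lam k)\<^sup>2) - (\<Sum>k<n. (lam k)\<^sup>2)\<bar> \<le> 134 * sqrt n ^ 3"
    unfolding sum_split_half[OF nh(1)] by linarith
  have "\<exists>I. I \<subseteq> {..<n} \<and> \<bar>2 * (\<Sum>k\<in>I. (lam k)\<^sup>2) - (\<Sum>k<n. (lam k)\<^sup>2)\<bar> \<le> 134 * sqrt n ^ 3
      \<and> M = (\<lambda>i j. \<Sum>k\<in>I. lam k * u k i * u k j)"
    using M
  proof
    assume "M = part_plus n lam u"
    then show ?thesis using up nh
      by (intro exI[of _ "{..<h}"]) (auto simp: part_plus_def h_def[symmetric] fun_eq_iff)
  next
    assume "M = part_minus n lam u"
    then show ?thesis using dn nh
      by (intro exI[of _ "{h..<n}"]) (auto simp: part_minus_def h_def[symmetric] fun_eq_iff)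
  qed
  then obtain I where I: "I \<subseteq> {..<n}"
    "\<bar>2 * (\<Sum>k\<in>I. (lam k)\<^sup>2) - (\<Sum>k<n. (lam k)\<^sup>2)\<bar> \<le> 134 * sqrt n ^ 3"
    "M = (\<lambda>i j. \<Sum>k\<in>I. lam k * u k i * u k j)" by blast
  note * = spectral_averages[OF o X less_imp_le[OF rows] I(1) I(2) n(2) I(3)]
  show "\<bar>avg_over (edge_pairs n G) M - 1/2\<bar> \<le> 9216 / sqrt n"
    "\<bar>avg_over (nonedge_pairs n G) M + 1/2\<bar> \<le> 9216 / sqrt n" using * by simp_all
qed

section \<open>Union bound over the bad events\<close>

lemma avg_over_diff: "avg_over S (\<lambda>i j. A i j - B i j) = avg_over S A - avg_over S B"
  by (simp add: avg_over_def case_prod_unfold sum_subtractf diff_divide_distrib)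

theorem theoremA7:
  fixes \<epsilon> :: real
  assumes "0 < \<epsilon>" and "\<epsilon> < 1/4"
  shows "\<exists>C K C' N. \<forall>n::nat. n \<ge> N \<and> even n \<longrightarrow>
    measure_pmf.prob (gnp_half n)
      {G. \<forall>lam u. is_spectral_decomp n (pm_adj G) lam u \<longrightarrow>
         (let E = edge_pairs n G; NE = nonedge_pairs n G;
              Xp = part_plus n lam u; Xm = part_minus n lam u;
              Z = (\<lambda>i j. Xm i j - Xp i j); b = C' * real n powr (2 * \<epsilon> - 1/2)
          in \<bar>avg_over E Xp - 1/2\<bar> \<le> b \<and> \<bar>avg_over E Xm - 1/2\<bar> \<le> b \<and>
             \<bar>avg_over NE Xp + 1/2\<bar> \<le> b \<and> \<bar>avg_over NE Xm + 1/2\<bar> \<le> b \<and>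
             \<bar>avg_over E Z\<bar> \<le> b \<and> \<bar>avg_over NE Z\<bar> \<le> b)}
    \<ge> 1 - C * (ln (real n)) ^ (K::nat) / real n"
proof (intro exI allI impI)
  \<comment> \<open>The witnesses are \<open>C = 3128\<close>, \<open>K = 1\<close>,
    \<open>C' = 18432\<close> and \<open>N = 100\<close>. \<open>C'\<close> is twice 9216 because
    \<open>Z\<close> is a difference of two averages with the same target.\<close>
  fix n :: nat
  assume n: "n \<ge> 100 \<and> even n"
  let ?P = "measure_pmf.prob (gnp_half n)"
  let ?good = "{G. \<forall>lam u. is_spectral_decomp n (pm_adj G) lam u \<longrightarrow>
         (let E = edge_pairs n G; NE = nonedge_pairs n G;
              Xp = part_plus n lam u; Xm = part_minus n lam u;
              Z = (\<lambda>i j. Xm i j - Xp i j); b = 18432 * real n powr (2 * \<epsilon> - 1/2)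
          in \<bar>avg_over E Xp - 1/2\<bar> \<le> b \<and> \<bar>avg_over E Xm - 1/2\<bar> \<le> b \<and>
             \<bar>avg_over NE Xp + 1/2\<bar> \<le> b \<and> \<bar>avg_over NE Xm + 1/2\<bar> \<le> b \<and>
             \<bar>avg_over E Z\<bar> \<le> b \<and> \<bar>avg_over NE Z\<bar> \<le> b)}"
  define L where "L = nat \<lceil>log 2 (real n)\<rceil>"
  define D :: "real set" where "D = insert 0 ((\<lambda>j. 2 ^ j) ` {..L})"
  \<comment> \<open>The bad events depend on \<open>G\<close> only, so avoiding them serves all
    spectral decompositions at once.\<close>
  define rowbad where "rowbad = {G. (\<Sum>i<n. (row_sum n G i)\<^sup>2) \<ge> 5 * (real n)\<^sup>2}"
  define gapbad where "gapbad s = {G. \<bar>pos_energy n s (pm_adj G)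
     - pos_energy n s (pm_adj (all_pairs n - G))\<bar> \<ge> 2 * real n powr (3/2)}" for s
  have n1: "real n \<ge> 100" using n by simp
  have lnn: "1 \<le> ln (real n)"
    using n1 exp_le by (subst ln_ge_iff) auto
  have L2: "real n \<le> 2 ^ L"
  proof -
    have "real n = 2 powr (log 2 (real n))" using n1 by simp
    also have "\<dots> \<le> 2 powr real L" unfolding L_def by (intro powr_mono real_nat_ceiling_ge) auto
    finally show ?thesis by (simp add: powr_realpow)
  qed
  have finD: "finite D" by (simp add: D_def)
  have cD: "real (card D) \<le> 5 * ln (real n)"
  proof -
    have "card D \<le> Suc (card ((\<lambda>j. (2::real) ^ j) ` {..L}))"
      unfolding D_def by (rule card_insert_le_m1) auto
    also have "\<dots> \<le> Suc (Suc L)" using card_image_le[of "{..L}" "\<lambda>j. (2::real) ^ j"] by simp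
    finally have "real (card D) \<le> real L + 2" by simp
    also have "real L \<le> log 2 (real n) + 1"
      unfolding L_def using n1 by (simp add: of_nat_nat)
    also have "log 2 (real n) \<le> 2 * ln (real n)"
    proof -
      have "ln (real n) * 1 \<le> ln (real n) * (2 * ln 2)"
        using ln2_ge_two_thirds lnn by (intro mult_left_mono) auto
      then show ?thesis by (simp add: log_def field_simps)
    qed
    finally show ?thesis using lnn by simp
  qed
  have sub: "- (rowbad \<union> (\<Union>s\<in>D. gapbad s)) \<subseteq> ?good"
  proof
    fix G assume G: "G \<in> - (rowbad \<union> (\<Union>s\<in>D. gapbad s))"
    have rows: "(\<Sum>i<n. (row_sum n G i)\<^sup>2) < 5 * (real n)\<^sup>2"
      using G by (auto simp: rowbad_def)
    have gap: "\<bar>pos_energy n s (pm_adj G) - pos_energy n s (pm_adj (all_pairs n - G))\<bar>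
        < 2 * real n powr (3/2)" if "s \<in> insert 0 ((\<lambda>j. 2 ^ j) ` {..L})" for s
    proof -
      have "G \<notin> gapbad s" using G that unfolding D_def by blast
      then show ?thesis by (simp add: gapbad_def)
    qed
    define b where "b = 9216 / sqrt n"
    have b: "2 * b \<le> 18432 * real n powr (2 * \<epsilon> - 1/2)" "0 \<le> b"
    proof -
      \<comment> \<open>The rate obtained is \<open>n powr (- 1/2)\<close>, which lies below the
        stated one as \<epsilon> is positive.\<close>
      have "1 / sqrt n = real n powr (- (1/2))"
        using n1 by (simp add: powr_minus powr_half_sqrt inverse_eq_divide)
      also have "\<dots> \<le> real n powr (2 * \<epsilon> - 1/2)"
        using n1 assms by (intro powr_mono) auto
      finally show "2 * b \<le> 18432 * real n powr (2 * \<epsilon> - 1/2)" by (simp add: b_def)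
    qed (simp add: b_def)
    show "G \<in> ?good"
      unfolding mem_Collect_eq Let_def avg_over_diff
    proof (intro allI impI)
      fix lam u assume sd: "is_spectral_decomp n (pm_adj G) lam u"
      have "even n" "100 \<le> n" using n by auto
      note h = half_spectrum_averages[OF sd this rows L2 gap, folded b_def]
      have "\<bar>avg_over (edge_pairs n G) (part_plus n lam u) - 1/2\<bar> \<le> b"
        "\<bar>avg_over (edge_pairs n G) (part_minus n lam u) - 1/2\<bar> \<le> b"
        "\<bar>avg_over (nonedge_pairs n G) (part_plus n lam u) + 1/2\<bar> \<le> b"
        "\<bar>avg_over (nonedge_pairs n G) (part_minus n lam u) + 1/2\<bar> \<le> b"
        using h by blast+
      then show "\<bar>avg_over (edge_pairs n G) (part_plus n lam u) - 1 / 2\<bar> \<le> 18432 * real n powr (2 * \<epsilon> - 1 / 2) \<and>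
        \<bar>avg_over (edge_pairs n G) (part_minus n lam u) - 1 / 2\<bar> \<le> 18432 * real n powr (2 * \<epsilon> - 1 / 2) \<and>
        \<bar>avg_over (nonedge_pairs n G) (part_plus n lam u) + 1 / 2\<bar> \<le> 18432 * real n powr (2 * \<epsilon> - 1 / 2) \<and>
        \<bar>avg_over (nonedge_pairs n G) (part_minus n lam u) + 1 / 2\<bar> \<le> 18432 * real n powr (2 * \<epsilon> - 1 / 2) \<and>
        \<bar>avg_over (edge_pairs n G) (part_minus n lam u) - avg_over (edge_pairs n G) (part_plus n lam u)\<bar>
          \<le> 18432 * real n powr (2 * \<epsilon> - 1 / 2) \<and>
        \<bar>avg_over (nonedge_pairs n G) (part_minus n lam u) - avg_over (nonedge_pairs n G) (part_plus n lam u)\<bar>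
          \<le> 18432 * real n powr (2 * \<epsilon> - 1 / 2)"
        using b by (intro conjI) linarith+
    qed
  qed
  have "?P (rowbad \<union> (\<Union>s\<in>D. gapbad s)) \<le> ?P rowbad + ?P (\<Union>s\<in>D. gapbad s)"
    by (intro measure_Un_le) auto
  also have "?P (\<Union>s\<in>D. gapbad s) \<le> (\<Sum>s\<in>D. ?P (gapbad s))"
    using finD by (intro measure_UNION_le) auto
  also have "\<dots> \<le> (\<Sum>s\<in>D. 600 / real n)"
    unfolding gapbad_def using n by (intro sum_mono prob_energy_gap) (auto simp: D_def)
  also have "\<dots> = 600 * real (card D) / real n" by simp
  also have "\<dots> \<le> 600 * (5 * ln (real n)) / real n"
    using cD n1 by (intro divide_right_mono mult_left_mono) auto
  also have "?P rowbad \<le> 128 / real n"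
    unfolding rowbad_def using n by (intro prob_row_sums_large) auto
  \<comment> \<open>3128 = 128 + 600 * 5, where \<open>1 \<le> ln n\<close> absorbs the row sum
    term.\<close>
  also have "128 / real n + 600 * (5 * ln (real n)) / real n \<le> 3128 * ln (real n) ^ 1 / real n"
    using lnn n1 by (simp add: field_simps)
  finally have "1 - 3128 * ln (real n) ^ 1 / real n \<le> 1 - ?P (rowbad \<union> (\<Union>s\<in>D. gapbad s))" by simp
  also have "\<dots> = ?P (- (rowbad \<union> (\<Union>s\<in>D. gapbad s)))"
    using measure_pmf.prob_compl[of "rowbad \<union> (\<Union>s\<in>D. gapbad s)" "gnp_half n"]
    by (simp add: Compl_eq_Diff_UNIV)
  also have "\<dots> \<le> ?P ?good"
    by (intro measure_pmf.finite_measure_mono sub) auto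
  finally show "1 - 3128 * ln (real n) ^ 1 / real n \<le> ?P ?good" .
qed

end
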